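(* Let $p$ be a prime and let $A,\Gamma\subset\mathbb{F}_p^*$ be two multiplicative subgroups with $|A|<\sqrt p$ and $|\Gamma|<p^{3/4}$. Suppose that $A'\subseteq A+s$ for some $s\in\mathbb{F}_p$, and that $A'-A'\subseteq\xi\Gamma\sqcup\{0\}$ for some $\xi\in\mathbb{F}_p^*$. Then $$|A'|^6\ll|A|^4|\Gamma|^{2/3}\log|A|.$$ In particular, if $A-A\subseteq\xi\Gamma\sqcup\{0\}$ then $|A|\ll|\Gamma|^{1/3}\log^{1/2}|\Gamma|$.
   Context: $X\ll Y$ means $X\le cY$ with an absolute constant $c>0$.
   Formalization: Both bounds are stated under the extra assumption |A| ≥ 2, since for A = {1} and |A'| = 1 the factor log|A| is 0 and the first bound fails, as does the second bound for A = Γ = {1}. *)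

theory Defs
  imports Complex_Main "HOL-Computational_Algebra.Primes"
begin

text \<open>The prime field F_p is modelled by the residues {0..<p} of int, with arithmetic mod p.\<close>

definition mult_subgroup :: "int \<Rightarrow> int set \<Rightarrow> bool" where
  "mult_subgroup p G \<longleftrightarrow> G \<subseteq> {1..<p} \<and> 1 \<in> G \<and>
     (\<forall>x\<in>G. \<forall>y\<in>G. (x * y) mod p \<in> G) \<and>
     (\<forall>x\<in>G. \<exists>y\<in>G. (x * y) mod p = 1)"

definition shift_mod :: "int \<Rightarrow> int set \<Rightarrow> int \<Rightarrow> int set" where
  "shift_mod p A s = {(a + s) mod p | a. a \<in> A}"

definition diff_mod :: "int \<Rightarrow> int set \<Rightarrow> int set" where
  "diff_mod p A = {(x - y) mod p | x y. x \<in> A \<and> y \<in> A}"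

definition dilate_mod :: "int \<Rightarrow> int \<Rightarrow> int set \<Rightarrow> int set" where
  "dilate_mod p \<xi> G = {(\<xi> * g) mod p | g. g \<in> G}"

end

theory Submission
  imports Defs "HOL-Computational_Algebra.Polynomial" "HOL-Number_Theory.Cong" "HOL-Analysis.Convex"
begin

text \<open>
  Translate \<open>A'\<close> to a subset \<open>B\<close> of \<open>A\<close>. For distinct \<open>a, b, c\<close> in \<open>B\<close> the ratio
  \<open>\<lambda> = (b - a) / (c - a)\<close> satisfies \<open>\<lambda> \<in> \<Gamma>\<close> and \<open>\<lambda> - 1 = (b - c) / (c - a) \<in> \<Gamma>\<close>, so it takes
  \<open>O(|\<Gamma>|\<^bsup>2/3\<^esup>)\<close> values by Stepanov's method. Two triples with the same ratio form a collinear triple of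
  points of \<open>A \<times> A\<close>, so by Cauchy-Schwarz \<open>|B|\<^sup>6\<close> is at most \<open>O(|\<Gamma>|\<^bsup>2/3\<^esup>)\<close> times the number of such
  collinear triples. Dividing by the first point, these are \<open>|A|\<^sup>2\<close> times the number of pairs of points
  collinear with \<open>(1, 1)\<close>, which is a sum of cubes of the numbers of solutions of
  \<open>x - y = 1\<close> with \<open>x, y\<close> in prescribed cosets of \<open>A\<close>. Stepanov's method applied to many pairs of cosets
  at once shows that only \<open>O(|A|\<^sup>2 / n\<^sup>3)\<close> pairs of cosets have at least \<open>n\<close> solutions, and the sum of cubes is
  \<open>O(|A|\<^sup>2 log |A|)\<close>.
\<close>

section \<open>Polynomials modulo a prime\<close>

text \<open>Since \<open>p\<close> is a variable, F_p[X] is handled inside Z[X], with divisibility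
  by the constant polynomial \<open>[:p:]\<close> as equality. The size hypotheses are degree
  conditions: orders of vanishing are read off from derivatives and coefficients from products of
  differences of exponents, so both the orders and the exponents of \<open>X\<close> must stay
  within \<open>p\<close>. For \<open>M\<close> pairs of cosets of a group of order \<open>t\<close>
  this becomes \<open>t^4 M \<le> p^3\<close>. With one pair this is the condition on |\<Gamma>|;
  with up to |A|^2 pairs it follows from |A|^2 \<le> p. The main obstacle in Stepanov's method is
  that the auxiliary polynomial might vanish modulo \<open>p\<close> although its coefficients do
  not. Its shape, a combination of \<open>X^(a + t b) (X - 1)^(t c)\<close> with few values of
  \<open>a\<close> and \<open>b\<close>, is chosen to exclude this. A further restriction is that
  the number of pairs must be at most a small multiple of \<open>t^2\<close>; larger families are
  replaced by subfamilies. The logarithm is a harmonic sum over the number \<open>n\<close> of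
  solutions.\<close>

definition vanishes_mod :: "int \<Rightarrow> int \<Rightarrow> nat \<Rightarrow> int poly \<Rightarrow> bool" where
  "vanishes_mod p x m F \<longleftrightarrow> (\<exists>G. [:p:] dvd F - [:- x, 1:] ^ m * G)"

lemma const_dvd_imp_dvd_poly:
  fixes F :: "int poly"
  assumes "[:p:] dvd F"
  shows "p dvd poly F x"
  using assms by (auto elim!: dvdE)

lemma const_dvd_imp_dvd_coeff:
  fixes F :: "int poly"
  assumes "[:p:] dvd F"
  shows "p dvd coeff F i"
  using assms by (simp add: const_poly_dvd_iff)

text \<open>\<open>[:p:]\<close> is a prime element of Z[X] and does not divide the monic
  \<open>X - x\<close>, so primality removes the power.\<close>

lemma const_dvd_linear_mult_cancel:
  fixes F :: "int poly"
  assumes "prime p" and "[:p:] dvd [:- x, 1:] ^ m * F"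
  shows "[:p:] dvd F"
proof -
  have pe: "prime_elem [:p:]"
    using assms(1) by (simp add: prime_elem_const_poly_iff del: prime_elem_iff_prime_abs)
  have "\<not> p dvd coeff [:- x, 1:] 1"
    using prime_gt_1_int[OF assms(1)] by simp
  then have "\<not> [:p:] dvd [:- x, 1:]"
    by (metis const_dvd_imp_dvd_coeff)
  then have "\<not> [:p:] dvd [:- x, 1:] ^ m"
    using pe prime_elem_dvd_power by blast
  then show ?thesis
    using assms(2) pe prime_elem_dvd_mult_iff by blast
qed

lemma linear_factor_mod:
  fixes G :: "int poly"
  assumes "p dvd poly G x"
  obtains G' where "[:p:] dvd G - [:- x, 1:] * G'"
proof
  have "G - [:- x, 1:] * synthetic_div G x = [:poly G x:]"
    using synthetic_div_correct'[of x G] by (metis add_diff_cancel_left')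
  then show "[:p:] dvd G - [:- x, 1:] * synthetic_div G x"
    using assms by (simp add: const_poly_dvd_iff coeff_pCons split: nat.split)
qed

lemma vanishes_mod_Suc:
  assumes "[:p:] dvd F - [:- x, 1:] ^ m * G" and "p dvd poly G x"
  shows "vanishes_mod p x (Suc m) F"
proof -
  obtain G' where "[:p:] dvd G - [:- x, 1:] * G'"
    using linear_factor_mod[OF assms(2)] .
  then have "[:p:] dvd (F - [:- x, 1:] ^ m * G) + [:- x, 1:] ^ m * (G - [:- x, 1:] * G')"
    using assms(1) by (intro dvd_add dvd_mult)
  also have "\<dots> = F - [:- x, 1:] ^ Suc m * G'"
    by (simp only: power_Suc) algebra
  finally show ?thesis
    unfolding vanishes_mod_def by blast
qed

lemma pderiv_linear_power_mult:
  fixes G :: "int poly"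
  shows "pderiv ([:- x, 1:] ^ Suc m * G + [:p:] * H) =
    [:- x, 1:] ^ m * (of_nat (Suc m) * G + [:- x, 1:] * pderiv G) + [:p:] * pderiv H"
proof -
  have X: "pderiv ([:- x, 1:] ^ Suc m) = of_nat (Suc m) * [:- x, 1:] ^ m"
    by (simp only: pderiv_power_Suc of_nat_mult_conv_smult) (simp add: pderiv_pCons)
  have H: "pderiv ([:p:] * H) = [:p:] * pderiv H"
    by (simp add: pderiv_smult)
  show ?thesis
    unfolding pderiv_add H pderiv_mult[of "[:- x, 1:] ^ Suc m"] X unfolding power_Suc by algebra
qed

text \<open>A first-order operator costs one order of vanishing. The form with \<open>w\<close> and
  \<open>v\<close> covers the operators \<open>X F' - e F\<close> that remove one exponent
  \<open>e\<close> at a time.\<close>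

lemma vanishes_mod_SucD:
  assumes "vanishes_mod p x (Suc m) F"
  shows "vanishes_mod p x m (w * pderiv F + v * F)"
proof -
  let ?X = "[:- x, 1:]"
  obtain G H where "F - ?X ^ Suc m * G = [:p:] * H"
    using assms unfolding vanishes_mod_def dvd_def by blast
  then have F: "F = ?X ^ Suc m * G + [:p:] * H"
    by (metis diff_add_cancel add.commute)
  have F': "pderiv F = ?X ^ m * (of_nat (Suc m) * G + ?X * pderiv G) + [:p:] * pderiv H"
    unfolding F by (rule pderiv_linear_power_mult)
  have "w * pderiv F + v * F -
      ?X ^ m * (w * (of_nat (Suc m) * G + ?X * pderiv G) + v * ?X * G)
      = [:p:] * (w * pderiv H + v * H)"
    unfolding F' unfolding F power_Suc by algebra
  then show ?thesis
    unfolding vanishes_mod_def by (metis dvd_triv_left)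
qed

lemma vanishes_mod_imp_dvd_poly:
  assumes "vanishes_mod p x (Suc m) F"
  shows "p dvd poly F x"
proof -
  obtain G where "[:p:] dvd F - [:- x, 1:] ^ Suc m * G"
    using assms unfolding vanishes_mod_def by blast
  from const_dvd_imp_dvd_poly[OF this, of x] show ?thesis
    by simp
qed

text \<open>Modulo \<open>p\<close> the factor \<open>Q\<close> is a unit at \<open>x\<close>, so
  the whole order of vanishing of \<open>Q * G\<close> belongs to \<open>G\<close>. The factors
  \<open>X - x\<close> are split off from \<open>G\<close> one by one and cancelled by
  primality.\<close>

lemma vanishes_mod_cofactor:
  assumes p: "prime p" and "\<not> p dvd poly Q x"
    and "[:p:] dvd Q * G - [:- x, 1:] ^ m * G'"
  shows "vanishes_mod p x m G"
  using assms(3)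
proof (induction m arbitrary: G G')
  case 0
  show ?case
    unfolding vanishes_mod_def by (rule exI[of _ G]) simp
next
  case (Suc m)
  let ?X = "[:- x, 1:]"
  have "p dvd poly (Q * G) x"
    using const_dvd_imp_dvd_poly[OF Suc.prems, of x] by simp
  then have "p dvd poly G x"
    using p assms(2) by (simp add: prime_dvd_mult_iff)
  then obtain G1 where G1: "[:p:] dvd G - ?X * G1"
    by (rule linear_factor_mod)
  have "[:p:] dvd (Q * G - ?X ^ Suc m * G') - Q * (G - ?X * G1)"
    by (rule dvd_diff[OF Suc.prems dvd_mult[OF G1]])
  also have "\<dots> = ?X ^ 1 * (Q * G1 - ?X ^ m * G')"
    unfolding power_Suc by algebra
  finally have "[:p:] dvd Q * G1 - ?X ^ m * G'"
    by (rule const_dvd_linear_mult_cancel[OF p])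
  then obtain G2 where G2: "[:p:] dvd G1 - ?X ^ m * G2"
    using Suc.IH unfolding vanishes_mod_def by blast
  have "[:p:] dvd (G - ?X * G1) + ?X * (G1 - ?X ^ m * G2)"
    using G1 G2 by (intro dvd_add dvd_mult)
  also have "\<dots> = G - ?X ^ Suc m * G2"
    unfolding power_Suc by algebra
  finally show ?case
    unfolding vanishes_mod_def by blast
qed

lemma prod_vanishing_factor_mod:
  assumes p: "prime p" and "finite S" and "S \<subseteq> {0..<p}"
    and "\<And>x. x \<in> S \<Longrightarrow> vanishes_mod p x m F"
  shows "\<exists>G. [:p:] dvd F - (\<Prod>x\<in>S. [:- x, 1:] ^ m) * G"
  using assms(2-4)
proof (induction S rule: finite_induct)
  case empty
  show ?case by (rule exI[of _ F]) simp
next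
  case (insert x S)
  let ?Q = "\<Prod>y\<in>S. [:- y, 1:] ^ m" and ?X = "[:- x, 1:] ^ m"
  obtain G where G: "[:p:] dvd F - ?Q * G"
    using insert by auto
  obtain G' where G': "[:p:] dvd F - ?X * G'"
    using insert.prems unfolding vanishes_mod_def by auto
  have "\<not> p dvd x - y" if "y \<in> S" for y
  proof
    assume "p dvd x - y"
    then have "x mod p = y mod p" by (simp add: mod_eq_dvd_iff)
    moreover have "x \<in> {0..<p}" "y \<in> {0..<p}" using insert.prems that by auto
    ultimately show False using insert.hyps that by simp
  qed
  then have "\<not> p dvd poly ?Q x"
    using p insert.hyps(1) by (auto simp: poly_prod prime_dvd_prod_iff dest!: prime_dvd_power)
  moreover have "[:p:] dvd ?Q * G - ?X * G'"
    using dvd_diff[OF G' G] by (simp add: algebra_simps)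
  ultimately obtain G2 where "[:p:] dvd G - ?X * G2"
    using vanishes_mod_cofactor[OF p] unfolding vanishes_mod_def by blast
  then have "[:p:] dvd (F - ?Q * G) + ?Q * (G - ?X * G2)"
    using G by (intro dvd_add dvd_mult)
  also have "\<dots> = F - (\<Prod>y\<in>insert x S. [:- y, 1:] ^ m) * G2"
    using insert.hyps by (simp add: algebra_simps)
  finally show ?case by blast
qed

lemma card_vanishing_le_degree:
  assumes p: "prime p" and "finite S" and "S \<subseteq> {0..<p}"
    and "\<And>x. x \<in> S \<Longrightarrow> vanishes_mod p x m F"
    and nz: "\<not> [:p:] dvd F"
  shows "m * card S \<le> degree F"
proof -
  let ?Q = "\<Prod>x\<in>S. [:- x, 1:] ^ m"
  obtain G where G: "[:p:] dvd F - ?Q * G"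
    using prod_vanishing_factor_mod[OF assms(1-4)] by blast
  \<comment> \<open>The cofactor is reduced coefficientwise so that its leading coefficient is not
    divisible by \<open>p\<close>. As \<open>?Q\<close> is monic, the leading coefficient of
    \<open>?Q * R\<close> survives modulo \<open>p\<close> and forces a nonzero coefficient of
    \<open>F\<close> in that degree.\<close>
  define R where "R = map_poly (\<lambda>c. c mod p) G"
  have cR: "coeff R i = coeff G i mod p" for i
    unfolding R_def by (simp add: coeff_map_poly)
  have "[:p:] dvd G - R"
    by (simp add: const_poly_dvd_iff cR)
  then have "[:p:] dvd (F - ?Q * G) + ?Q * (G - R)"
    using G by (intro dvd_add dvd_mult)
  then have FR: "[:p:] dvd F - ?Q * R"
    by (simp add: algebra_simps)
  have "R \<noteq> 0"
    using FR nz by auto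
  then have "lead_coeff R \<noteq> 0" by simp
  then have "\<not> p dvd coeff R (degree R)"
    unfolding cR by (simp add: dvd_eq_mod_eq_0)
  moreover have monic: "lead_coeff ?Q = 1"
    by (simp add: lead_coeff_prod lead_coeff_power)
  ultimately have "\<not> p dvd lead_coeff (?Q * R)"
    by (metis lead_coeff_mult mult_1)
  moreover have "p dvd coeff F (degree (?Q * R)) - lead_coeff (?Q * R)"
    using const_dvd_imp_dvd_coeff[OF FR, of "degree (?Q * R)"] by simp
  ultimately have "coeff F (degree (?Q * R)) \<noteq> 0"
    by force
  then have "degree (?Q * R) \<le> degree F"
    by (rule le_degree)
  moreover have "?Q \<noteq> 0" using monic by force
  moreover have "degree ?Q = m * card S"
    by (subst degree_prod_eq_sum_degree) (auto simp: degree_power_eq)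
  ultimately show ?thesis
    using \<open>R \<noteq> 0\<close> by (simp add: degree_mult_eq)
qed

text \<open>To raise the order from \<open>m\<close> to \<open>m + 1\<close>, two facts about
  \<open>w F'\<close> are compared: it vanishes to order \<open>m\<close> by induction, while
  differentiating \<open>F = (X - x)^m G\<close> leaves the term \<open>m w G\<close> at order
  \<open>m - 1\<close>. Hence \<open>p\<close> divides \<open>m w(x) G(x)\<close>, and the
  multipliers \<open>m\<close> that occur lie strictly below \<open>p\<close>.\<close>

lemma vanishes_mod_if_iterated_derivs:
  assumes p: "prime p" and w: "\<not> p dvd poly w x" and "int m \<le> p"
    and "\<And>n. n < m \<Longrightarrow> p dvd poly (((\<lambda>f. w * pderiv f) ^^ n) F) x"
  shows "vanishes_mod p x m F"
  using assms(3,4)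
proof (induction m arbitrary: F)
  case 0
  show ?case unfolding vanishes_mod_def by (rule exI[of _ F]) simp
next
  case (Suc m)
  let ?X = "[:- x, 1:]"
  obtain G where G: "[:p:] dvd F - ?X ^ m * G"
    using Suc.IH[of F] Suc.prems unfolding vanishes_mod_def by force
  have "p dvd poly G x"
  proof (cases m)
    case 0
    then show ?thesis
      using const_dvd_imp_dvd_poly[OF G, of x] Suc.prems(2)[of 0]
      by (simp add: dvd_diff_right_iff)
  next
    case (Suc k)
    have "vanishes_mod p x m (w * pderiv F)"
    proof (rule Suc.IH)
      fix n assume "n < m"
      then show "p dvd poly (((\<lambda>f. w * pderiv f) ^^ n) (w * pderiv F)) x"
        using Suc.prems(2)[of "Suc n"] by (simp add: funpow_Suc_right del: funpow.simps)
    qed (use Suc.prems in simp)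
    then obtain Y where Y: "[:p:] dvd w * pderiv F - ?X ^ m * Y"
      unfolding vanishes_mod_def by blast
    obtain H where "F - ?X ^ m * G = [:p:] * H"
      using G by (elim dvdE)
    then have F: "F = ?X ^ Suc k * G + [:p:] * H"
      unfolding Suc by (metis diff_add_cancel add.commute)
    have F': "pderiv F = ?X ^ k * (of_nat m * G + ?X * pderiv G) + [:p:] * pderiv H"
      unfolding F Suc by (rule pderiv_linear_power_mult)
    have "w * pderiv F - ?X ^ m * Y - [:p:] * (w * pderiv H) =
        ?X ^ k * (w * (of_nat m * G + ?X * pderiv G) - ?X * Y)"
      unfolding F' unfolding Suc power_Suc by algebra
    then have "[:p:] dvd ?X ^ k * (w * (of_nat m * G + ?X * pderiv G) - ?X * Y)"
      using Y by (metis dvd_diff dvd_triv_left)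
    then have "[:p:] dvd w * (of_nat m * G + ?X * pderiv G) - ?X * Y"
      by (rule const_dvd_linear_mult_cancel[OF p])
    from const_dvd_imp_dvd_poly[OF this, of x] have "p dvd poly w x * (int m * poly G x)"
      by simp
    moreover have "\<not> p dvd int m"
      using Suc Suc.prems(1) zdvd_imp_le[of p "int m"] by auto
    ultimately show ?thesis
      using p w by (simp add: prime_dvd_mult_iff)
  qed
  with G show ?case by (rule vanishes_mod_Suc)
qed

section \<open>Sparse polynomials and linear systems modulo a prime\<close>

lemma coeff_X_mult_pderiv:
  fixes F :: "int poly"
  shows "coeff ([:0, 1:] * pderiv F) i = of_nat i * coeff F i"
  by (cases i) (simp_all add: coeff_pderiv)

text \<open>
  Applying the operators \<open>F \<mapsto> X F' - e F\<close> for all exponents but one isolates a single coefficient.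
\<close>

lemma vanishes_mod_1_sum:
  assumes "finite E" and "vanishes_mod p 1 (Suc (card E)) F"
  shows "p dvd (\<Sum>i\<le>degree F. coeff F i * (\<Prod>e\<in>E. (int i - int e)))"
  using assms
proof (induction E arbitrary: F rule: finite_induct)
  case empty
  have "p dvd poly F 1" using vanishes_mod_imp_dvd_poly empty by blast
  then show ?case by (simp add: poly_altdef)
next
  case (insert e E)
  let ?F = "[:0, 1:] * pderiv F + [:- int e:] * F"
  have cF: "coeff ?F i = coeff F i * (int i - int e)" for i
    unfolding coeff_add coeff_X_mult_pderiv by (simp add: algebra_simps)
  have "p dvd (\<Sum>i\<le>degree ?F. coeff ?F i * (\<Prod>e\<in>E. (int i - int e)))"
    using insert by (intro insert.IH vanishes_mod_SucD) simp
  also have "(\<Sum>i\<le>degree ?F. coeff ?F i * (\<Prod>e\<in>E. (int i - int e)))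
      = (\<Sum>i\<le>degree F. coeff ?F i * (\<Prod>e\<in>E. (int i - int e)))"
  proof (rule sum.mono_neutral_left)
    show "{..degree ?F} \<subseteq> {..degree F}"
      using degree_le[of "degree F" ?F] by (simp only: cF) (simp add: coeff_eq_0)
    show "\<forall>i\<in>{..degree F} - {..degree ?F}. coeff ?F i * (\<Prod>e\<in>E. (int i - int e)) = 0"
    proof
      fix i assume "i \<in> {..degree F} - {..degree ?F}"
      then have "coeff ?F i = 0" by (intro coeff_eq_0) simp
      then show "coeff ?F i * (\<Prod>e\<in>E. (int i - int e)) = 0" by (simp only: mult_zero_left)
    qed
  qed simp
  finally show ?case
    using insert by (simp only: cF) (simp add: mult_ac)
qed

text \<open>This is a Vandermonde principle: the exponents in \<open>E - {i}\<close> eliminate every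
  coefficient but the one at \<open>i\<close>, which is left with the product of all
  \<open>i - e\<close>. Exponents below \<open>p\<close> are distinct modulo \<open>p\<close>, so
  that product is prime to \<open>p\<close>.\<close>

lemma sparse_poly_vanishing_at_1:
  assumes p: "prime p" and "finite E" and "card E \<le> m"
    and lt: "\<And>e. e \<in> E \<Longrightarrow> int e < p"
    and supp: "\<And>i. i \<notin> E \<Longrightarrow> coeff F i = 0"
    and van: "vanishes_mod p 1 m F"
  shows "p dvd coeff F i"
proof (cases "i \<in> E")
  case True
  let ?E = "E - {i}"
  have cE: "Suc (card ?E) = card E" using True \<open>finite E\<close> by (metis card_Suc_Diff1)
  obtain k where m: "m = card E + k" using \<open>card E \<le> m\<close> le_Suc_ex by blast
  have "vanishes_mod p 1 (card E) F"
    using van unfolding vanishes_mod_def m power_add by (metis mult.assoc)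
  then have "p dvd (\<Sum>j\<le>degree F. coeff F j * (\<Prod>e\<in>?E. (int j - int e)))"
    using \<open>finite E\<close> cE by (intro vanishes_mod_1_sum) auto
  also have "(\<Sum>j\<le>degree F. coeff F j * (\<Prod>e\<in>?E. (int j - int e))) =
      (\<Sum>j\<in>{i}. coeff F j * (\<Prod>e\<in>?E. (int j - int e)))"
  proof (rule sum.mono_neutral_cong)
    fix j assume "j \<in> {..degree F} - {i}"
    then show "coeff F j * (\<Prod>e\<in>?E. (int j - int e)) = 0"
      using supp[of j] \<open>finite E\<close> by (cases "j \<in> E") auto
  qed (auto simp: coeff_eq_0)
  finally have "p dvd coeff F i * (\<Prod>e\<in>?E. (int i - int e))" by simp
  moreover have "\<not> p dvd (\<Prod>e\<in>?E. (int i - int e))"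
  proof
    assume "p dvd (\<Prod>e\<in>?E. (int i - int e))"
    then obtain e where e: "e \<in> ?E" "p dvd int i - int e"
      using p \<open>finite E\<close> by (auto simp: prime_dvd_prod_iff)
    then have "int i mod p = int e mod p" by (simp add: mod_eq_dvd_iff)
    then show False using e lt[of e] lt[of i] True by simp
  qed
  ultimately show ?thesis using p by (simp add: prime_dvd_mult_iff)
qed (use supp in simp)

text \<open>Pigeonhole replaces linear algebra: there are more vectors of residues than vectors of
  values of the system, so two of them collide, and their difference is a nontrivial
  solution.\<close>

lemma homogeneous_system_mod:
  fixes a :: "'e \<Rightarrow> 'i \<Rightarrow> int"
  assumes p: "p > 1" and I: "finite I" and E: "finite E" and less: "card E < card I"
  obtains u where "\<exists>i\<in>I. \<not> p dvd u i" and "\<And>e. e \<in> E \<Longrightarrow> p dvd (\<Sum>i\<in>I. u i * a e i)"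
proof -
  let ?D = "I \<rightarrow>\<^sub>E {0..<p}" and ?R = "E \<rightarrow>\<^sub>E {0..<p}"
  define f where "f u = (\<lambda>e\<in>E. (\<Sum>i\<in>I. u i * a e i) mod p)" for u :: "'i \<Rightarrow> int"
  have fR: "f ` ?D \<subseteq> ?R" using p by (auto simp: f_def)
  have "card (f ` ?D) \<le> card ?R"
    using E by (intro card_mono fR finite_PiE) auto
  also have "\<dots> = nat p ^ card E" using E by (simp add: card_PiE)
  also have "\<dots> < nat p ^ card I" using less p by (intro power_strict_increasing) auto
  also have "\<dots> = card ?D" using I by (simp add: card_PiE)
  finally have "\<not> inj_on f ?D" by (rule pigeonhole)
  then obtain u v where uv: "u \<in> ?D" "v \<in> ?D" "f u = f v" "u \<noteq> v"
    unfolding inj_on_def by blast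
  obtain i where i: "i \<in> I" "u i \<noteq> v i"
    using uv PiE_ext[OF uv(1,2)] by blast
  show thesis
  proof (rule that[of "\<lambda>i. u i - v i"])
    have "u i mod p = u i" "v i mod p = v i" using uv i by (auto simp: PiE_iff)
    then have "\<not> p dvd u i - v i" using i by (metis mod_eq_dvd_iff)
    with i show "\<exists>i\<in>I. \<not> p dvd u i - v i" by blast
  next
    fix e assume "e \<in> E"
    then have "(\<Sum>i\<in>I. u i * a e i) mod p = (\<Sum>i\<in>I. v i * a e i) mod p"
      using fun_cong[OF uv(3), of e] by (simp add: f_def)
    then have "p dvd (\<Sum>i\<in>I. u i * a e i) - (\<Sum>i\<in>I. v i * a e i)"
      by (simp add: mod_eq_dvd_iff)
    then show "p dvd (\<Sum>i\<in>I. (u i - v i) * a e i)"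
      by (simp add: sum_subtractf left_diff_distrib)
  qed
qed

section \<open>The Stepanov polynomial\<close>

text \<open>
  If \<open>t\<close> is the order of a subgroup, a pair of \<open>t\<close>-th powers encodes a pair of its cosets, and the
  fiber consists of the \<open>x\<close> in the first coset with \<open>x - 1\<close> in the second.
\<close>

definition power_fiber :: "int \<Rightarrow> nat \<Rightarrow> int \<times> int \<Rightarrow> int set" where
  "power_fiber p t k = {x \<in> {0..<p}. [x ^ t = fst k] (mod p) \<and> [(x - 1) ^ t = snd k] (mod p)}"

lemma X_mult_pderiv_power:
  fixes X :: "int poly"
  assumes "pderiv X = 1"
  shows "X * pderiv (X ^ m) = of_nat m * X ^ m"
proof (cases m)
  case (Suc k)
  show ?thesis
    unfolding Suc pderiv_power_Suc assms by (simp add: of_nat_mult_conv_smult del: of_nat_Suc)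
qed simp

text \<open>Conjugating a derivation by \<open>X^m (X - 1)^l\<close> only adds the logarithmic
  derivative of that product; the factor \<open>X (X - 1)\<close> clears its denominators, leaving
  \<open>m (X - 1) + l X\<close>.\<close>

lemma twisted_pderiv:
  fixes q :: "int poly"
  defines "X \<equiv> [:0, 1:]" and "Y \<equiv> [:- 1, 1:]"
  shows "X * Y * pderiv (X ^ m * Y ^ l * q) =
    X ^ m * Y ^ l * (X * Y * pderiv q + (of_nat m * Y + of_nat l * X) * q)"
proof -
  have "X * Y * pderiv (X ^ m * Y ^ l * q) =
    X ^ m * Y ^ l * (X * Y * pderiv q) + (X * pderiv (X ^ m)) * Y * Y ^ l * q
      + X ^ m * X * (Y * pderiv (Y ^ l)) * q"
    unfolding pderiv_mult by algebra
  also have "X * pderiv (X ^ m) = of_nat m * X ^ m"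
    by (rule X_mult_pderiv_power) (simp add: X_def pderiv_pCons)
  also have "Y * pderiv (Y ^ l) = of_nat l * Y ^ l"
    by (rule X_mult_pderiv_power) (simp add: Y_def pderiv_pCons)
  also have "X ^ m * Y ^ l * (X * Y * pderiv q) + of_nat m * X ^ m * Y * Y ^ l * q
      + X ^ m * X * (of_nat l * Y ^ l) * q =
      X ^ m * Y ^ l * (X * Y * pderiv q + (of_nat m * Y + of_nat l * X) * q)"
    by algebra
  finally show ?thesis .
qed

lemma degree_twisted_pderiv:
  fixes q r :: "int poly"
  assumes "degree q \<le> d" and "degree r \<le> 1"
  shows "degree ([:0, 1:] * [:- 1, 1:] * pderiv q + r * q) \<le> Suc d"
proof (rule degree_add_le)
  show "degree ([:0, 1:] * [:- 1, 1:] * pderiv q) \<le> Suc d"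
  proof (cases "degree q = 0")
    case True
    then show ?thesis by (metis pderiv_eq_0_iff mult_zero_right degree_0 zero_le)
  next
    case False
    have "degree ([:0, 1:] * [:- 1, 1:] * pderiv q) \<le> degree ([:0, 1:] * [:- 1, 1 :: int:]) + degree (pderiv q)"
      by (rule degree_mult_le)
    with False assms(1) show ?thesis by (simp add: degree_pderiv)
  qed
  show "degree (r * q) \<le> Suc d"
    using degree_mult_le[of r q] assms by simp
qed

lemma not_dvd_power_fiber:
  assumes p: "prime p" and t: "t > 0" and k: "k \<in> {1..<p} \<times> {1..<p}" and x: "x \<in> power_fiber p t k"
  shows "\<not> p dvd x" and "\<not> p dvd x - 1"
proof -
  have *: "\<not> p dvd y" if "[y ^ t = c] (mod p)" "c \<in> {1..<p}" for y c
  proof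
    assume "p dvd y"
    then have "p dvd y ^ t" using t by (meson dvd_power dvd_trans)
    then have "p dvd c" using that(1) by (simp add: cong_dvd_iff)
    then show False using that(2) zdvd_imp_le[of p c] by auto
  qed
  show "\<not> p dvd x" "\<not> p dvd x - 1"
    using * x k unfolding power_fiber_def by force+
qed

text \<open>The blocks \<open>\<Phi> c * (X - 1)^(t c)\<close> could cancel each other. If they did,
  let \<open>c0\<close> be the least index whose \<open>\<Phi>\<close> is nonzero modulo
  \<open>p\<close>; after division by \<open>(X - 1)^(t c0)\<close>, all later blocks still carry
  \<open>(X - 1)^t\<close>, so \<open>\<Phi> c0\<close> vanishes at 1 to order \<open>t\<close>. But
  it has at most \<open>t\<close> terms, with exponents below \<open>p\<close>.\<close>

lemma stepanov_polynomial_nonzero: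
  fixes u :: "nat \<times> nat \<Rightarrow> int"
  assumes p: "prime p" and E: "finite E" "card E \<le> t" "\<And>e. e \<in> E \<Longrightarrow> int e < p"
    and nz: "\<exists>i\<in>E \<times> {..<B}. \<not> p dvd u i"
  shows "\<not> [:p:] dvd (\<Sum>(e, c)\<in>E \<times> {..<B}. [:u (e, c):] * ([:0, 1:] ^ e * [:- 1, 1:] ^ (t * c)))"
proof
  let ?Y = "[:- 1, 1 :: int:]"
  define \<Phi> where "\<Phi> c = (\<Sum>e\<in>E. monom (u (e, c)) e)" for c
  have coeff_\<Phi>: "coeff (\<Phi> c) i = (if i \<in> E then u (i, c) else 0)" for c i
    using E(1) by (simp add: \<Phi>_def coeff_sum)
  assume "[:p:] dvd (\<Sum>(e, c)\<in>E \<times> {..<B}. [:u (e, c):] * ([:0, 1:] ^ e * [:- 1, 1:] ^ (t * c)))"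
  also have "(\<Sum>(e, c)\<in>E \<times> {..<B}. [:u (e, c):] * ([:0, 1:] ^ e * [:- 1, 1:] ^ (t * c))) =
      (\<Sum>c<B. ?Y ^ (t * c) * \<Phi> c)"
    unfolding sum.cartesian_product[symmetric] sum.swap[of _ E] \<Phi>_def sum_distrib_left
    by (intro sum.cong refl) (simp add: monom_altdef mult.commute)
  finally have F: "[:p:] dvd (\<Sum>c<B. ?Y ^ (t * c) * \<Phi> c)" .
  define c0 where "c0 = (LEAST c. \<not> [:p:] dvd \<Phi> c)"
  obtain e1 c1 where c1: "c1 < B" "e1 \<in> E" "\<not> p dvd u (e1, c1)"
    using nz by auto
  then have "\<not> [:p:] dvd \<Phi> c1"
    using coeff_\<Phi>[of c1 e1] const_dvd_imp_dvd_coeff[of p "\<Phi> c1" e1] by auto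
  then have c0: "\<not> [:p:] dvd \<Phi> c0" "c0 \<le> c1" and min: "\<And>c. c < c0 \<Longrightarrow> [:p:] dvd \<Phi> c"
    unfolding c0_def by (fact LeastI, fact Least_le, use not_less_Least in blast)
  define R where "R = (\<Sum>c\<in>{Suc c0..<B}. ?Y ^ (t * (c - Suc c0)) * \<Phi> c)"
  have "(\<Sum>c<B. f c) = (\<Sum>c<c0. f c) + (f c0 + (\<Sum>c\<in>{Suc c0..<B}. f c))"
    for f :: "nat \<Rightarrow> int poly"
    using c0(2) c1(1)
    by (simp add: lessThan_atLeast0 flip: sum.atLeast_Suc_lessThan sum.atLeastLessThan_concat[of 0 c0 B])
  note sum_split = this[of "\<lambda>c. ?Y ^ (t * c) * \<Phi> c"]
  have sum_tail: "(\<Sum>c\<in>{Suc c0..<B}. ?Y ^ (t * c) * \<Phi> c) = ?Y ^ (t * c0) * (?Y ^ t * R)"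
    unfolding R_def sum_distrib_left
  proof (intro sum.cong refl)
    fix c assume "c \<in> {Suc c0..<B}"
    then obtain d where d: "c = Suc c0 + d" using le_Suc_ex[of "Suc c0" c] by auto
    have "t * c = t * c0 + (t + t * (c - Suc c0))"
      unfolding d by (simp add: algebra_simps)
    then show "?Y ^ (t * c) * \<Phi> c = ?Y ^ (t * c0) * (?Y ^ t * (?Y ^ (t * (c - Suc c0)) * \<Phi> c))"
      by (simp only: power_add mult.assoc)
  qed
  have "[:p:] dvd (\<Sum>c<c0. ?Y ^ (t * c) * \<Phi> c)"
    using min by (intro dvd_sum dvd_mult) auto
  then have "[:p:] dvd ?Y ^ (t * c0) * \<Phi> c0 + ?Y ^ (t * c0) * (?Y ^ t * R)"
    using F unfolding sum_split sum_tail by (simp only: dvd_add_right_iff)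
  then have "[:p:] dvd ?Y ^ (t * c0) * (\<Phi> c0 - ?Y ^ t * (- R))"
    by (simp only: distrib_left mult_minus_right diff_minus_eq_add)
  then have "[:p:] dvd \<Phi> c0 - ?Y ^ t * (- R)"
    by (rule const_dvd_linear_mult_cancel[OF p])
  then have "vanishes_mod p 1 t (\<Phi> c0)"
    unfolding vanishes_mod_def by blast
  then have "p dvd coeff (\<Phi> c0) i" for i
    using E by (intro sparse_poly_vanishing_at_1[OF p E(1,2)]) (auto simp: coeff_\<Phi>)
  then show False
    using c0(1) by (simp add: const_poly_dvd_iff)
qed

text \<open>
  Since the twisted derivation \<open>f \<mapsto> X (X - 1) f'\<close> maps \<open>X\<^sup>m (X - 1)\<^sup>l q\<close> to \<open>X\<^sup>m (X - 1)\<^sup>l q'\<close> with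
  \<open>deg q' \<le> deg q + 1\<close>, vanishing of its \<open>n\<close>-th iterate on a whole fiber costs fewer than
  \<open>A + n\<close> linear conditions, however large the fiber is.
\<close>

theorem stepanov_method:
  fixes A B t :: nat
  assumes p: "prime p" and "A > 0" and AB: "A * B \<le> t" and deg: "int (A + t * B) \<le> p"
    and \<Theta>: "finite \<Theta>" "\<Theta> \<subseteq> {1..<p} \<times> {1..<p}" and less: "2 * card \<Theta> * A < B\<^sup>2"
  shows "A * card (\<Union>k\<in>\<Theta>. power_fiber p t k) \<le> A + 2 * t * B"
proof -
  let ?X = "[:0, 1 :: int:]" and ?Y = "[:- 1, 1 :: int:]"
  have "B > 0" using less by (cases B) auto
  then have At: "A \<le> t" using AB by (metis le_trans mult_le_mono2 mult.right_neutral Suc_leI One_nat_def)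
  then have t: "t > 0" using \<open>A > 0\<close> by simp
  \<comment> \<open>An exponent splits uniquely into \<open>a\<close> and \<open>b\<close> because
    \<open>A \<le> t\<close>. On a fiber \<open>X^(t b)\<close> is constant, so only
    \<open>X^a\<close> contributes to the degree there.\<close>
  define E where "E = (\<lambda>(a, b). a + t * b) ` ({..<A} \<times> {..<B})"
  have "inj_on (\<lambda>(a, b). a + t * b) ({..<A} \<times> {..<B})"
  proof (rule inj_onI, clarify)
    fix a b a' b' assume "a < A" "a' < A" "a + t * b = a' + t * b'"
    then have "(a + t * b) mod t = (a' + t * b') mod t" "(a + t * b) div t = (a' + t * b') div t"
      "a < t" "a' < t" using At by auto
    then show "a = a' \<and> b = b'" by simp
  qed
  then have cardE: "card E = A * B" unfolding E_def by (simp add: card_image)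
  have "finite E" unfolding E_def by simp
  have E: "e mod t < A" "e div t < B" "e < A + t * B" if "e \<in> E" for e
  proof -
    obtain a b where e: "e = a + t * b" "a < A" "b < B" using \<open>e \<in> E\<close> unfolding E_def by auto
    then show "e mod t < A" "e div t < B" using At by auto
    have "t * b \<le> t * B" using e by simp
    then show "e < A + t * B" using e by linarith
  qed
  define w where "w = ?X * ?Y"
  define r where "r b c = of_nat (t * b) * ?Y + of_nat (t * c) * ?X" for b c
  \<comment> \<open>\<open>L b c\<close> is the derivation \<open>f \<mapsto> w f'\<close> read on
    the cofactor of \<open>X^(t b) (X - 1)^(t c)\<close>.\<close>
  define L where "L b c q = w * pderiv q + r b c * q" for b c q
  define \<theta> where "\<theta> = (\<lambda>f. w * pderiv f)"
  have degL: "degree ((L b c ^^ n) (?X ^ a)) \<le> a + n" for a b c n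
  proof (induction n)
    case 0
    show ?case using degree_power_le[of ?X a] by simp
  next
    case (Suc n)
    have "degree (r b c) \<le> 1"
      unfolding r_def
      by (intro degree_add_le) (simp_all add: of_nat_mult_conv_smult del: of_nat_mult mult_pCons_right)
    from degree_twisted_pderiv[OF Suc this] show ?case
      by (simp add: L_def w_def del: mult_pCons_left mult_pCons_right)
  qed
  define I where "I = E \<times> {..<B}"
  \<comment> \<open>One equation for each key, each order \<open>n < A\<close> and each coefficient
    of a cofactor, whose degree is at most \<open>a + n < 2 * A\<close>. With \<open>M\<close> keys
    these are \<open>2 M A^2\<close> equations in \<open>A B^2\<close> unknowns, which is where the
    hypothesis \<open>less\<close> comes from.\<close>
  define J where "J = \<Theta> \<times> {..<A} \<times> {..<2 * A}"
  define m where "m = (\<lambda>(k :: int \<times> int, n, i) (e, c).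
    fst k ^ (e div t) * snd k ^ c * coeff ((L (e div t) c ^^ n) (?X ^ (e mod t))) i)"
  have "finite I" "finite J" using \<open>finite E\<close> \<Theta> by (auto simp: I_def J_def)
  moreover have "card J < card I"
  proof -
    have "card J = (2 * card \<Theta> * A) * A" by (simp add: J_def card_cartesian_product)
    also have "\<dots> < B\<^sup>2 * A" using less \<open>A > 0\<close> by simp
    also have "\<dots> = card I" by (simp add: I_def cardE power2_eq_square card_cartesian_product)
    finally show ?thesis .
  qed
  ultimately obtain u where u: "\<exists>i\<in>I. \<not> p dvd u i"
      "\<And>j. j \<in> J \<Longrightarrow> p dvd (\<Sum>i\<in>I. u i * m j i)"
    using homogeneous_system_mod[of p I J m] prime_gt_1_int[OF p] by blast
  define F where "F = (\<Sum>(e, c)\<in>I. [:u (e, c):] * (?X ^ e * ?Y ^ (t * c)))"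
  have \<theta>F: "(\<theta> ^^ n) F = (\<Sum>(e, c)\<in>I. [:u (e, c):] *
      (?X ^ (t * (e div t)) * ?Y ^ (t * c) * (L (e div t) c ^^ n) (?X ^ (e mod t))))" for n
  proof (induction n)
    case 0
    have X: "?X ^ e = ?X ^ (t * (e div t)) * ?X ^ (e mod t)" for e
      by (metis power_add mult_div_mod_eq)
    show ?case unfolding F_def funpow_0
      by (intro sum.cong refl, clarify, subst X) (simp only: mult_ac)
  next
    case (Suc n)
    have \<theta>_sum: "\<theta> (sum f I) = (\<Sum>i\<in>I. \<theta> (f i))" for f
      unfolding \<theta>_def higher_pderiv_sum[where n = 1, simplified] by (simp add: sum_distrib_left)
    have \<theta>_const: "\<theta> ([:a:] * f) = [:a:] * \<theta> f" for a f
      by (simp add: \<theta>_def pderiv_smult)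
    have \<theta>_twist: "\<theta> (?X ^ (t * b) * ?Y ^ (t * c) * q) = ?X ^ (t * b) * ?Y ^ (t * c) * L b c q" for b c q
      unfolding \<theta>_def L_def r_def w_def by (rule twisted_pderiv)
    show ?case
      unfolding funpow.simps comp_def Suc \<theta>_sum
      by (intro sum.cong refl) (simp only: split_beta \<theta>_const \<theta>_twist)
  qed
  have van: "vanishes_mod p x A F" if k: "k \<in> \<Theta>" and x: "x \<in> power_fiber p t k" for k x
  proof (rule vanishes_mod_if_iterated_derivs[OF p])
    show "\<not> p dvd poly w x"
      using not_dvd_power_fiber[OF p t _ x] k \<Theta>(2) p by (auto simp: w_def prime_dvd_mult_iff)
    show "int A \<le> p" using deg by (metis le_add1 of_nat_mono order_trans)
    fix n assume n: "n < A"
    have xt: "[x ^ t = fst k] (mod p)" "[(x - 1) ^ t = snd k] (mod p)"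
      using x unfolding power_fiber_def by auto
    let ?q = "\<lambda>e c. (L (e div t) c ^^ n) (?X ^ (e mod t))"
    have step1: "poly ((\<theta> ^^ n) F) x =
        (\<Sum>(e, c)\<in>I. u (e, c) * ((x ^ t) ^ (e div t) * ((x - 1) ^ t) ^ c * poly (?q e c) x))"
      unfolding \<theta>F poly_sum by (intro sum.cong refl) (simp add: split_beta flip: power_mult)
    \<comment> \<open>With \<open>x^t\<close> and \<open>(x - 1)^t\<close> replaced by the entries
      of the key, the iterate agrees at \<open>x\<close> with a polynomial of degree below
      \<open>2 * A\<close>, whose coefficients \<open>u\<close> makes divisible by
      \<open>p\<close>.\<close>
    have step2: "[(\<Sum>(e, c)\<in>I. u (e, c) * ((x ^ t) ^ (e div t) * ((x - 1) ^ t) ^ c * poly (?q e c) x)) =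
        (\<Sum>(e, c)\<in>I. u (e, c) * (fst k ^ (e div t) * snd k ^ c * poly (?q e c) x))] (mod p)"
      unfolding split_beta by (intro cong_sum cong_mult cong_pow cong_refl xt)
    have "(\<Sum>(e, c)\<in>I. u (e, c) * (fst k ^ (e div t) * snd k ^ c * poly (?q e c) x)) =
        (\<Sum>(e, c)\<in>I. \<Sum>i<2 * A. u (e, c) * m (k, n, i) (e, c) * x ^ i)"
    proof (rule sum.cong[OF refl], unfold split_paired_all split_conv)
      fix e c assume "(e, c) \<in> I"
      then have "e mod t < A" using E(1) unfolding I_def by blast
      then have "degree (?q e c) < 2 * A"
        using degL[of n "e div t" c "e mod t"] n by linarith
      then have "poly (?q e c) x = (\<Sum>i<2 * A. coeff (?q e c) i * x ^ i)"
        unfolding poly_altdef by (intro sum.mono_neutral_left) (auto simp: coeff_eq_0)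
      then show "u (e, c) * (fst k ^ (e div t) * snd k ^ c * poly (?q e c) x) =
          (\<Sum>i<2 * A. u (e, c) * m (k, n, i) (e, c) * x ^ i)"
        by (simp add: m_def sum_distrib_left mult_ac)
    qed
    also have "\<dots> = (\<Sum>i<2 * A. (\<Sum>j\<in>I. u j * m (k, n, i) j) * x ^ i)"
      unfolding split_beta sum_distrib_right by (subst sum.swap) simp
    also have "p dvd \<dots>"
    proof (rule dvd_sum, rule dvd_mult2)
      fix i assume "i \<in> {..<2 * A}"
      then show "p dvd (\<Sum>j\<in>I. u j * m (k, n, i) j)"
        using u(2)[of "(k, n, i)"] k n by (simp add: J_def)
    qed
    finally show "p dvd poly (((\<lambda>f. w * pderiv f) ^^ n) F) x"
      unfolding step1[unfolded \<theta>_def] cong_dvd_iff[OF step2] .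
  qed
  have "A * card (\<Union>k\<in>\<Theta>. power_fiber p t k) \<le> degree F"
  proof (rule card_vanishing_le_degree[OF p])
    show "(\<Union>k\<in>\<Theta>. power_fiber p t k) \<subseteq> {0..<p}"
      by (auto simp: power_fiber_def)
    then show "finite (\<Union>k\<in>\<Theta>. power_fiber p t k)"
      by (rule finite_subset) simp
    show "\<not> [:p:] dvd F"
      unfolding F_def I_def
    proof (rule stepanov_polynomial_nonzero[OF p \<open>finite E\<close>])
      fix e assume "e \<in> E"
      then have "int e < int (A + t * B)" using E(3) by (simp only: of_nat_less_iff)
      then show "int e < p" using deg by linarith
    qed (use u(1) cardE AB in \<open>auto simp: I_def\<close>)
  qed (use van in auto)
  also have "degree F \<le> A + 2 * t * B"
    unfolding F_def
  proof (intro degree_sum_le \<open>finite I\<close>, clarify)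
    fix e c assume "(e, c) \<in> I"
    then have ec: "e < A + t * B" "t * c \<le> t * B" using E(3) unfolding I_def by auto
    have "degree ([:u (e, c):] * (?X ^ e * ?Y ^ (t * c))) \<le> degree (?X ^ e) + degree (?Y ^ (t * c))"
      using degree_mult_le[of "[:u (e, c):]" "?X ^ e * ?Y ^ (t * c)"]
        degree_mult_le[of "?X ^ e" "?Y ^ (t * c)"] by simp
    also have "\<dots> \<le> e + t * c"
      using degree_power_le[of ?X e] degree_power_le[of ?Y "t * c"] by simp
    finally show "degree ([:u (e, c):] * (?X ^ e * ?Y ^ (t * c))) \<le> A + 2 * t * B"
      using ec by linarith
  qed
  finally show ?thesis .
qed

section \<open>Choice of parameters and bounds for fibers\<close>

lemma ex_cube_root_bound:
  fixes n :: nat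
  assumes "8 \<le> n"
  obtains B where "B > 0" and "8 * B ^ 3 \<le> n" and "n \<le> 64 * B ^ 3"
proof -
  define B where "B = (GREATEST b. 8 * b ^ 3 \<le> n)"
  have bound: "b \<le> n" if "8 * b ^ 3 \<le> n" for b :: nat
  proof -
    have "b \<le> b ^ 3" by (cases b) (simp_all add: power3_eq_cube)
    then show ?thesis using that by simp
  qed
  have one: "8 * 1 ^ 3 \<le> n" using assms by simp
  have B: "8 * B ^ 3 \<le> n"
    unfolding B_def by (rule GreatestI_nat[of "\<lambda>b. 8 * b ^ 3 \<le> n" 1 n]) (fact one, fact bound)
  have "1 \<le> B"
    unfolding B_def by (rule Greatest_le_nat[of "\<lambda>b. 8 * b ^ 3 \<le> n" 1 n]) (fact one, fact bound)
  have "\<not> 8 * (Suc B) ^ 3 \<le> n"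
    using Greatest_le_nat[of "\<lambda>b. 8 * b ^ 3 \<le> n" "Suc B" n] bound unfolding B_def[symmetric] by fastforce
  moreover have "(Suc B) ^ 3 \<le> (2 * B) ^ 3"
    using \<open>1 \<le> B\<close> by (intro power_mono) auto
  ultimately show thesis
    using that[of B] B \<open>1 \<le> B\<close> by (simp add: power_mult_distrib)
qed

text \<open>Write \<open>M\<close> for the number of keys and \<open>S\<close> for the size of the
  union. The condition \<open>64^3 M \<le> t^2\<close> ensures \<open>4 M \<le> B^2\<close>, hence
  \<open>A > 0\<close>; the condition on \<open>p\<close> bounds the exponents. The constant arises
  from \<open>S B \<le> 24 M t\<close> and \<open>t M \<le> 64 B^3\<close>, as
  \<open>64 * 24^3 = 96^3\<close>.\<close>

theorem card_power_fibers_bound: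
  fixes t :: nat
  assumes p: "prime p" and \<Theta>: "finite \<Theta>" "\<Theta> \<subseteq> {1..<p} \<times> {1..<p}" "\<Theta> \<noteq> {}"
    and M_le: "64 ^ 3 * card \<Theta> \<le> t\<^sup>2" and p_ge: "int (t ^ 4 * card \<Theta>) \<le> p ^ 3"
  shows "card (\<Union>k\<in>\<Theta>. power_fiber p t k) ^ 3 \<le> 96 ^ 3 * (card \<Theta> * t)\<^sup>2"
proof -
  define M where "M = card \<Theta>"
  define S where "S = card (\<Union>k\<in>\<Theta>. power_fiber p t k)"
  have M: "M > 0" using \<Theta> by (simp add: M_def card_gt_0_iff)
  have "8\<^sup>2 \<le> t\<^sup>2" using M M_le unfolding M_def by simp
  then have t: "8 \<le> t" by (rule power2_le_imp_le) simp
  then have "8 * 1 \<le> t * M" using M by (intro mult_mono) auto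
  \<comment> \<open>With \<open>A\<close> about \<open>B\<^sup>2 / (4 M)\<close> the bound \<open>2 t B / A\<close> decreases in \<open>B\<close>, while the degree condition
    forces \<open>t B \<lesssim> p\<close>; hence \<open>B\<close> is taken about \<open>(t M)\<^bsup>1/3\<^esup> / 2\<close>.\<close>
  then obtain B where B: "B > 0" "8 * B ^ 3 \<le> t * M" "t * M \<le> 64 * B ^ 3"
    using ex_cube_root_bound[of "t * M"] by auto
  have B2: "4 * M \<le> B\<^sup>2"
  proof (rule power_le_imp_le_base)
    have "64\<^sup>2 * (4 * M) ^ 3 = 64 ^ 3 * M * M\<^sup>2"
      by (simp add: power2_eq_square power3_eq_cube)
    also have "\<dots> \<le> t\<^sup>2 * M\<^sup>2"
      using M_le unfolding M_def by (rule mult_right_mono) simp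
    also have "\<dots> = (t * M)\<^sup>2" by (simp add: power_mult_distrib)
    also have "\<dots> \<le> (64 * B ^ 3)\<^sup>2"
      using B(3) by (rule power_mono) simp
    also have "\<dots> = 64\<^sup>2 * (B\<^sup>2) ^ 3"
      by (simp add: power_mult_distrib flip: power_mult)
    finally show "(4 * M) ^ Suc 2 \<le> (B\<^sup>2) ^ Suc 2" by (simp add: numeral_3_eq_3)
  qed simp
  define A where "A = B\<^sup>2 div (4 * M)"
  have A: "A > 0" using B2 M by (simp add: A_def div_greater_zero_iff)
  have A_le: "4 * M * A \<le> B\<^sup>2" unfolding A_def by simp
  have "B\<^sup>2 < 4 * M * (A + 1)"
    unfolding A_def using M dividend_less_times_div[of "4 * M" "B\<^sup>2"] by simp
  also have "\<dots> \<le> 4 * M * (2 * A)" using A by (intro mult_left_mono) auto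
  finally have A_ge: "B\<^sup>2 \<le> 8 * M * A" by simp
  have AB: "A * B \<le> t"
  proof -
    have "M * (A * B) \<le> (4 * M * A) * B" by simp
    also have "\<dots> \<le> B\<^sup>2 * B" using A_le by (rule mult_right_mono) simp
    also have "\<dots> \<le> 8 * B ^ 3" by (simp add: power2_eq_square power3_eq_cube)
    also have "\<dots> \<le> M * t" using B by (simp add: mult.commute)
    finally show ?thesis using M by simp
  qed
  have "A * 1 \<le> A * B" "t * 1 \<le> t * B" using B(1) by (intro mult_left_mono; simp)+
  then have AtB: "A \<le> t * B" using AB by linarith
  \<comment> \<open>This is what the factor 8 in the choice of \<open>B\<close> is for:
    \<open>(2 t B)^3 = t^3 * 8 B^3 \<le> t^4 M\<close>.\<close>
  have "2 * int (t * B) \<le> p"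
  proof (rule power_le_imp_le_base)
    have "(2 * (t * B)) ^ 3 = t ^ 3 * (8 * B ^ 3)" by (simp add: power_mult_distrib)
    also have "\<dots> \<le> t ^ 3 * (t * M)" using B by (intro mult_left_mono) auto
    also have "\<dots> = t ^ 4 * M" by (simp add: power3_eq_cube power4_eq_xxxx)
    finally have "int ((2 * (t * B)) ^ 3) \<le> int (t ^ 4 * M)" by (simp only: of_nat_le_iff)
    then show "(2 * int (t * B)) ^ Suc 2 \<le> p ^ Suc 2"
      using p_ge unfolding M_def by simp
  qed (use prime_gt_1_int[OF p] in simp)
  moreover have "int A \<le> int (t * B)" using AtB by (simp only: of_nat_le_iff)
  ultimately have deg: "int (A + t * B) \<le> p" by simp
  have "2 * M * A < 4 * M * A" using M A by simp
  then have "2 * card \<Theta> * A < B\<^sup>2" using A_le unfolding M_def by linarith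
  from stepanov_method[OF p A AB deg \<Theta>(1,2) this]
  have AS: "A * S \<le> 3 * t * B" using AtB unfolding S_def by simp
  have "B * (S * B) = B\<^sup>2 * S" by (simp add: power2_eq_square)
  also have "\<dots> \<le> 8 * M * (A * S)" using A_ge by (metis mult_right_mono mult.assoc zero_le)
  also have "\<dots> \<le> 8 * M * (3 * t * B)" using AS by (rule mult_left_mono) simp
  also have "\<dots> = B * (24 * (M * t))" by simp
  finally have SB: "S * B \<le> 24 * (M * t)" using B(1) by simp
  have "S ^ 3 * (M * t) \<le> S ^ 3 * (64 * B ^ 3)"
    using B(3) by (intro mult_left_mono) (simp_all add: mult.commute)
  also have "\<dots> = 64 * (S * B) ^ 3" by (simp add: power_mult_distrib)
  also have "\<dots> \<le> 64 * (24 * (M * t)) ^ 3" using SB by (intro mult_left_mono power_mono) auto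
  also have "\<dots> = 96 ^ 3 * (M * t)\<^sup>2 * (M * t)"
    by (simp add: power3_eq_cube power2_eq_square)
  finally have "S ^ 3 \<le> 96 ^ 3 * (M * t)\<^sup>2" using M t by simp
  then show ?thesis unfolding S_def M_def .
qed

lemma card_nth_roots_le:
  fixes p :: int
  assumes p: "prime p" and t: "t > 0"
  shows "card {x \<in> {0..<p}. [x ^ t = c] (mod p)} \<le> t"
proof -
  let ?F = "monom 1 t - [:c:]"
  have "1 * card {x \<in> {0..<p}. [x ^ t = c] (mod p)} \<le> degree ?F"
  proof (rule card_vanishing_le_degree[OF p])
    fix x assume "x \<in> {x \<in> {0..<p}. [x ^ t = c] (mod p)}"
    then have "p dvd poly ?F x" by (simp add: poly_monom cong_iff_dvd_diff)
    then show "vanishes_mod p x 1 ?F"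
      using vanishes_mod_Suc[of p ?F x 0 ?F] by simp
  next
    have "\<not> p dvd coeff ?F t" using t prime_gt_1_int[OF p] by (cases t) auto
    then show "\<not> [:p:] dvd ?F" using const_dvd_imp_dvd_coeff by blast
  qed (auto intro: finite_subset[of _ "{0..<p}"])
  also have "degree ?F \<le> t" by (rule degree_diff_le) (simp_all add: degree_monom_le)
  finally show ?thesis by simp
qed

lemma finite_power_fiber [simp]: "finite (power_fiber p t k)"
  unfolding power_fiber_def by (rule finite_subset[of _ "{0..<p}"]) auto

lemma card_power_fiber_le:
  assumes "prime p" and "t > 0"
  shows "card (power_fiber p t k) \<le> t"
proof -
  have "card (power_fiber p t k) \<le> card {x \<in> {0..<p}. [x ^ t = fst k] (mod p)}"
    unfolding power_fiber_def
    by (intro card_mono) (auto intro: finite_subset[of _ "{0..<p}"])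
  then show ?thesis using card_nth_roots_le[OF assms] le_trans by blast
qed

lemma card_power_fiber_bound:
  assumes p: "prime p" and t: "t > 0" and k: "k \<in> {1..<p} \<times> {1..<p}" and "int (t ^ 4) \<le> p ^ 3"
  shows "card (power_fiber p t k) ^ 3 \<le> 96 ^ 3 * t\<^sup>2"
proof (cases "64 ^ 3 \<le> t\<^sup>2")
  case True
  then show ?thesis
    using card_power_fibers_bound[of p "{k}" t] assms by simp
next
  case False
  then have "t\<^sup>2 < 512\<^sup>2" by simp
  then have "t < 512" by (rule power_less_imp_less_base) simp
  have "card (power_fiber p t k) ^ 3 \<le> t ^ 3"
    using card_power_fiber_le[OF p t] by (rule power_mono) simp
  also have "\<dots> = t * t\<^sup>2" by (simp add: power3_eq_cube power2_eq_square)
  also have "\<dots> \<le> 96 ^ 3 * t\<^sup>2" using \<open>t < 512\<close> by (intro mult_right_mono) auto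
  finally show ?thesis .
qed

section \<open>Multiplicative subgroups\<close>

lemma cong_residues_eq:
  fixes p :: int
  assumes "[x = y] (mod p)" and "x \<in> {0..<p}" and "y \<in> {0..<p}"
  shows "x = y"
  using assms by (simp add: cong_def)

lemma cong_mult_cancel_prime:
  fixes p :: int
  assumes "prime p" and "\<not> p dvd c" and "[c * x = c * y] (mod p)"
  shows "[x = y] (mod p)"
  using assms by (simp add: cong_iff_dvd_diff prime_dvd_mult_iff flip: right_diff_distrib)

lemma ex_quotient_mod_prime:
  fixes p :: int
  assumes "prime p" and "\<not> p dvd x"
  obtains r where "r \<in> {0..<p}" and "[r * x = y] (mod p)"
proof -
  have "coprime x p"
    using assms by (simp add: prime_imp_coprime coprime_commute)
  then obtain z where "[x * z = 1] (mod p)"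
    using cong_solve_coprime_int by blast
  then have "[(y * z) mod p * x = y] (mod p)"
    by (metis cong_mod_left cong_refl cong_scalar_left cong_scalar_right cong_trans mult.commute
        mult.left_commute mult.right_neutral)
  then show thesis
    using that[of "(y * z) mod p"] prime_gt_1_int[OF assms(1)] by simp
qed

lemma not_dvd_residue:
  fixes p :: int
  assumes "x \<in> {1..<p}"
  shows "\<not> p dvd x"
  using assms zdvd_imp_le[of p x] by auto

context
  fixes p :: int and G :: "int set"
  assumes p: "prime p" and G: "mult_subgroup p G"
begin

lemma mult_subgroup_subset: "G \<subseteq> {1..<p}"
  using G unfolding mult_subgroup_def by blast

lemma finite_mult_subgroup: "finite G"
  using mult_subgroup_subset by (rule finite_subset) simp

lemma one_in_mult_subgroup: "1 \<in> G"
  using G unfolding mult_subgroup_def by blast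

lemma card_mult_subgroup_pos: "card G > 0"
  using finite_mult_subgroup one_in_mult_subgroup by (auto simp: card_gt_0_iff)

text \<open>Multiplication by \<open>x\<close> permutes \<open>G\<close>, so it leaves the product
  of all elements unchanged modulo \<open>p\<close> while multiplying it by
  \<open>x ^ card G\<close>; the product is prime to \<open>p\<close> and cancels.\<close>

lemma mult_subgroup_power_card:
  assumes x: "x \<in> G"
  shows "[x ^ card G = 1] (mod p)"
proof -
  let ?f = "\<lambda>y. (x * y) mod p"
  have "?f ` G \<subseteq> G" using G x unfolding mult_subgroup_def by blast
  moreover have inj: "inj_on ?f G"
  proof (rule inj_onI)
    fix y z assume yz: "y \<in> G" "z \<in> G" "?f y = ?f z"
    then have "[x * y = x * z] (mod p)" by (simp add: cong_def)
    then have "[y = z] (mod p)"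
      using cong_mult_cancel_prime[OF p] not_dvd_residue x mult_subgroup_subset by blast
    then show "y = z" using cong_residues_eq yz mult_subgroup_subset by fastforce
  qed
  ultimately have "?f ` G = G" by (simp add: endo_inj_surj finite_mult_subgroup)
  then have "\<Prod>G = (\<Prod>y\<in>G. ?f y)" using prod.reindex[OF inj, of "\<lambda>y. y"] by simp
  also have "[(\<Prod>y\<in>G. ?f y) = (\<Prod>y\<in>G. x * y)] (mod p)" by (intro cong_prod) simp
  finally have "[\<Prod>G * x ^ card G = \<Prod>G * 1] (mod p)"
    by (simp add: prod.distrib mult.commute cong_sym)
  moreover have "\<not> p dvd \<Prod>G"
    using p finite_mult_subgroup not_dvd_residue mult_subgroup_subset
    by (auto simp: prime_dvd_prod_iff)
  ultimately show ?thesis using cong_mult_cancel_prime[OF p] by blast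
qed

text \<open>The elements of \<open>G\<close> already exhaust the \<open>card G\<close> roots that
  the polynomial \<open>X^(card G) - 1\<close> can have.\<close>

lemma mult_subgroup_if_power_card:
  assumes "x \<in> {0..<p}" and "[x ^ card G = 1] (mod p)"
  shows "x \<in> G"
proof -
  let ?R = "{x \<in> {0..<p}. [x ^ card G = 1] (mod p)}"
  have "G = ?R"
  proof (rule card_seteq)
    show "finite ?R" by (rule finite_subset[of _ "{0..<p}"]) auto
    show "G \<subseteq> ?R" using mult_subgroup_subset mult_subgroup_power_card by force
    show "card ?R \<le> card G" using card_nth_roots_le[OF p card_mult_subgroup_pos] .
  qed
  then show ?thesis using assms by blast
qed

text \<open>Equal \<open>card G\<close>-th powers mean equal cosets of \<open>G\<close>, which is
  why powers can serve as names of cosets.\<close>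

lemma ex_mult_subgroup_quotient:
  assumes x: "\<not> p dvd x" and "[y ^ card G = x ^ card G] (mod p)"
  obtains r where "r \<in> G" and "[r * x = y] (mod p)"
proof -
  obtain r where r: "r \<in> {0..<p}" "[r * x = y] (mod p)"
    using ex_quotient_mod_prime[OF p x] by blast
  then have "[(r * x) ^ card G = x ^ card G] (mod p)"
    using assms(2) cong_pow cong_trans by blast
  then have "[x ^ card G * r ^ card G = x ^ card G * 1] (mod p)"
    by (simp add: power_mult_distrib mult.commute)
  moreover have "\<not> p dvd x ^ card G" using x p prime_dvd_power by blast
  ultimately have "[r ^ card G = 1] (mod p)" using cong_mult_cancel_prime[OF p] by blast
  then show thesis using that r mult_subgroup_if_power_card by blast
qed

end

section \<open>Pairs of cosets with many solutions\<close>

definition rich_keys :: "int \<Rightarrow> nat \<Rightarrow> nat \<Rightarrow> (int \<times> int) set" where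
  "rich_keys p t n = {k \<in> {1..<p} \<times> {1..<p}. n \<le> card (power_fiber p t k)}"

lemma finite_rich_keys [simp]: "finite (rich_keys p t n)"
  unfolding rich_keys_def by (rule finite_subset[of _ "{1..<p} \<times> {1..<p}"]) auto

lemma power_fiber_key_unique:
  assumes "x \<in> power_fiber p t k" and "x \<in> power_fiber p t l"
    and "k \<in> {1..<p} \<times> {1..<p}" and "l \<in> {1..<p} \<times> {1..<p}"
  shows "k = l"
proof -
  have "[fst k = fst l] (mod p)" "[snd k = snd l] (mod p)"
    using assms(1,2) unfolding power_fiber_def by (auto intro: cong_trans cong_sym)
  then show ?thesis
    using assms(3,4) cong_residues_eq[of "fst k" "fst l" p] cong_residues_eq[of "snd k" "snd l" p]
    by (auto simp: prod_eq_iff)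
qed

text \<open>Two distinct elements \<open>x\<close>, \<open>y\<close> of a fiber give ratios
  \<open>r = y / x\<close> and \<open>s = (y - 1) / (x - 1)\<close> in \<open>A\<close>. They
  determine \<open>x\<close> through \<open>(r - s) x = 1 - s\<close>, since \<open>r = s\<close>
  would force \<open>r = 1\<close> and \<open>x = y\<close>; and \<open>x\<close> determines the
  key.\<close>

lemma card_rich_keys_2_le:
  assumes p: "prime p" and A: "mult_subgroup p A"
  shows "card (rich_keys p (card A) 2) \<le> (card A)\<^sup>2"
proof -
  let ?t = "card A"
  let ?R = "\<lambda>k (r, s). \<exists>x\<in>power_fiber p ?t k. \<exists>y\<in>power_fiber p ?t k. x \<noteq> y \<and>
    [r * x = y] (mod p) \<and> [s * (x - 1) = y - 1] (mod p)"
  have "card (rich_keys p ?t 2) \<le> card (A \<times> A)"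
  proof (rule card_le_if_inj_on_rel[where r = ?R])
    show "finite (A \<times> A)" using finite_mult_subgroup[OF p A] by simp
  next
    fix k assume k: "k \<in> rich_keys p ?t 2"
    then have k': "k \<in> {1..<p} \<times> {1..<p}" "2 \<le> card (power_fiber p ?t k)"
      unfolding rich_keys_def by auto
    then obtain x y where xy: "x \<in> power_fiber p ?t k" "y \<in> power_fiber p ?t k" "x \<noteq> y"
      using card_le_Suc0_iff_eq[OF finite_power_fiber, of p ?t k] by force
    note nd = not_dvd_power_fiber[OF p card_mult_subgroup_pos[OF p A] k'(1) xy(1)]
    have "[y ^ ?t = x ^ ?t] (mod p)" "[(y - 1) ^ ?t = (x - 1) ^ ?t] (mod p)"
      using xy unfolding power_fiber_def by (auto intro: cong_trans cong_sym)
    then obtain r s where "r \<in> A" "[r * x = y] (mod p)" "s \<in> A" "[s * (x - 1) = y - 1] (mod p)"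
      using ex_mult_subgroup_quotient[OF p A] nd by metis
    then show "\<exists>rs. rs \<in> A \<times> A \<and> ?R k rs" using xy by auto
  next
    fix k l rs assume kl: "k \<in> rich_keys p ?t 2" "l \<in> rich_keys p ?t 2" and "?R k rs" "?R l rs"
    then obtain r s x y x' y' where
      x: "x \<in> power_fiber p ?t k" "y \<in> power_fiber p ?t k" "x \<noteq> y"
         "[r * x = y] (mod p)" "[s * (x - 1) = y - 1] (mod p)" and
      x': "x' \<in> power_fiber p ?t l" "[r * x' = y'] (mod p)" "[s * (x' - 1) = y' - 1] (mod p)"
      by (auto simp: split_beta)
    have rng: "x \<in> {0..<p}" "y \<in> {0..<p}" "x' \<in> {0..<p}"
      using x x' unfolding power_fiber_def by auto
    have a: "p dvd r * x - y" "p dvd s * (x - 1) - (y - 1)"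
      "p dvd r * x' - y'" "p dvd s * (x' - 1) - (y' - 1)"
      using x x' by (auto simp: cong_iff_dvd_diff)
    have "p dvd ((r * x - y) - (s * (x - 1) - (y - 1))) - ((r * x' - y') - (s * (x' - 1) - (y' - 1)))"
      by (intro dvd_diff a)
    also have "\<dots> = (r - s) * (x - x')" by algebra
    finally consider "p dvd r - s" | "p dvd x - x'" using p by (auto simp: prime_dvd_mult_iff)
    then show "k = l"
    proof cases
      case 1
      have "p dvd (x - 1) * (r - s) - (r * x - y) + (s * (x - 1) - (y - 1))"
        by (rule dvd_add[OF dvd_diff[OF dvd_mult[OF 1] a(1)] a(2)])
      also have "\<dots> = 1 - r" by algebra
      finally have "p dvd x * (1 - r) + (r * x - y)" using a by (intro dvd_add dvd_mult)
      then have "[x = y] (mod p)" by (simp add: cong_iff_dvd_diff algebra_simps)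
      then show ?thesis using cong_residues_eq rng x(3) by blast
    next
      case 2
      then have "x = x'" using cong_residues_eq rng by (simp add: cong_iff_dvd_diff)
      then show ?thesis
        using power_fiber_key_unique[OF x(1)] x'(1) kl unfolding rich_keys_def by blast
    qed
  qed
  then show ?thesis by (simp add: power2_eq_square card_cartesian_product)
qed

text \<open>Fibers of distinct keys are disjoint, so their union has at least
  \<open>n * card \<Theta>\<close> elements, and a factor \<open>(card \<Theta>)^2\<close> cancels
  after cubing. The hypothesis \<open>t^2 \<le> p\<close> yields the degree condition through
  \<open>t^4 * card \<Theta> \<le> t^6\<close>.\<close>

lemma card_rich_keys_subset_bound:
  fixes t n :: nat
  assumes p: "prime p" and tp: "int (t\<^sup>2) \<le> p"
    and \<Theta>: "\<Theta> \<subseteq> rich_keys p t n" "64 ^ 3 * card \<Theta> \<le> t\<^sup>2"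
  shows "n ^ 3 * card \<Theta> \<le> 96 ^ 3 * t\<^sup>2"
proof (cases "\<Theta> = {}")
  case False
  have fin: "finite \<Theta>" using \<Theta>(1) by (rule finite_subset) simp
  have sub: "\<Theta> \<subseteq> {1..<p} \<times> {1..<p}" using \<Theta>(1) unfolding rich_keys_def by blast
  have "t ^ 4 * card \<Theta> \<le> t ^ 4 * t\<^sup>2" using \<Theta>(2) by (intro mult_left_mono) auto
  also have "\<dots> = (t\<^sup>2) ^ 3" by (simp flip: power_mult power_add)
  finally have "int (t ^ 4 * card \<Theta>) \<le> int (t\<^sup>2) ^ 3" by (metis of_nat_le_iff of_nat_power)
  also have "\<dots> \<le> p ^ 3" using tp by (intro power_mono) auto
  finally have *: "card (\<Union>k\<in>\<Theta>. power_fiber p t k) ^ 3 \<le> 96 ^ 3 * (card \<Theta> * t)\<^sup>2"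
    using card_power_fibers_bound[OF p fin sub False \<Theta>(2)] by blast
  have "card \<Theta> * n = (\<Sum>k\<in>\<Theta>. n)" by simp
  also have "\<dots> \<le> (\<Sum>k\<in>\<Theta>. card (power_fiber p t k))"
    using \<Theta>(1) by (intro sum_mono) (auto simp: rich_keys_def)
  also have "\<dots> = card (\<Union>k\<in>\<Theta>. power_fiber p t k)"
  proof (rule card_UN_disjoint[symmetric])
    show "\<forall>k\<in>\<Theta>. \<forall>l\<in>\<Theta>. k \<noteq> l \<longrightarrow> power_fiber p t k \<inter> power_fiber p t l = {}"
      using power_fiber_key_unique sub by blast
  qed (simp_all add: fin)
  finally have "(card \<Theta> * n) ^ 3 \<le> 96 ^ 3 * (card \<Theta> * t)\<^sup>2"
    using * by (meson power_mono le_trans zero_le)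
  then have "(card \<Theta>)\<^sup>2 * (n ^ 3 * card \<Theta>) \<le> (card \<Theta>)\<^sup>2 * (96 ^ 3 * t\<^sup>2)"
    by (simp add: power_mult_distrib power3_eq_cube power2_eq_square mult_ac)
  moreover have "(card \<Theta>)\<^sup>2 > 0" using False fin by (simp add: card_gt_0_iff)
  ultimately show ?thesis by (simp only: mult_le_cancel1)
qed simp

text \<open>If there are too many rich keys for Stepanov's method, it is applied to \<open>m\<close>
  of them, with \<open>m\<close> the integer part of \<open>t^2 / 64^3\<close>. This bounds
  \<open>n\<close> by an absolute constant, and the trivial count \<open>t^2\<close> of keys
  finishes. The constant is \<open>2 * (64 * 96)^3\<close>, the 2 coming from
  \<open>t^2 < 64^3 (m + 1) \<le> 2 * 64^3 m\<close>. If \<open>t < 512\<close>, then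
  \<open>n \<le> t\<close> is bounded anyway.\<close>

lemma card_rich_keys_bound:
  assumes p: "prime p" and A: "mult_subgroup p A" and tp: "int ((card A)\<^sup>2) \<le> p" and n: "n \<ge> 2"
  shows "n ^ 3 * card (rich_keys p (card A) n) \<le> 2 * 6144 ^ 3 * (card A)\<^sup>2"
proof -
  let ?t = "card A" and ?\<Theta> = "rich_keys p (card A) n"
  note t = card_mult_subgroup_pos[OF p A]
  have "?\<Theta> \<subseteq> rich_keys p ?t 2" using n unfolding rich_keys_def by auto
  then have M: "card ?\<Theta> \<le> ?t\<^sup>2"
    using card_rich_keys_2_le[OF p A] card_mono[OF finite_rich_keys] le_trans by blast
  consider "64 ^ 3 * card ?\<Theta> \<le> ?t\<^sup>2" | "64 ^ 3 \<le> ?t\<^sup>2" "?t\<^sup>2 < 64 ^ 3 * card ?\<Theta>" | "?\<Theta> = {}"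
    | "?t\<^sup>2 < 64 ^ 3" "?\<Theta> \<noteq> {}"
    by force
  then show ?thesis
  proof cases
    case 1
    then show ?thesis using card_rich_keys_subset_bound[OF p tp order_refl 1] by simp
  next
    case 2
    define m where "m = ?t\<^sup>2 div 64 ^ 3"
    have m: "64 ^ 3 * m \<le> ?t\<^sup>2" "m > 0" "?t\<^sup>2 < 64 ^ 3 * (m + 1)"
      using 2(1) unfolding m_def by (simp_all add: div_greater_zero_iff)
    have "64 ^ 3 * m < 64 ^ 3 * card ?\<Theta>" using m(1) 2(2) by (rule le_less_trans)
    then have "m \<le> card ?\<Theta>" by simp
    then obtain \<Theta> where \<Theta>: "\<Theta> \<subseteq> ?\<Theta>" "card \<Theta> = m" using obtain_subset_with_card_n by metis
    have "m * n ^ 3 \<le> 96 ^ 3 * ?t\<^sup>2"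
      using card_rich_keys_subset_bound[OF p tp \<Theta>(1)] m(1) \<Theta>(2) by (simp add: mult.commute)
    also have "\<dots> \<le> m * (2 * 6144 ^ 3)" using m(2,3) by simp
    finally have "n ^ 3 \<le> 2 * 6144 ^ 3" using m(2) by (simp only: mult_le_cancel1)
    then show ?thesis using M by (rule mult_mono) auto
  next
    case 3
    then show ?thesis by simp
  next
    case 4
    then have "?t\<^sup>2 < 512\<^sup>2" by simp
    then have t512: "?t < 512" by (rule power_less_imp_less_base) simp
    obtain k where "k \<in> ?\<Theta>" using 4 by blast
    then have "n \<le> ?t"
      using card_power_fiber_le[OF p t, of k] unfolding rich_keys_def by simp
    then have "n ^ 3 \<le> 512 ^ 3" using t512 by (intro power_mono) auto
    then have "n ^ 3 \<le> 2 * 6144 ^ 3" by simp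
    then show ?thesis using M by (rule mult_mono) auto
  qed
qed

text \<open>This prepares a summation by parts; it starts at 2 because rich keys are counted only
  for \<open>n \<ge> 2\<close>.\<close>

lemma cube_le_sum_squares:
  fixes n :: nat
  assumes "n \<ge> 2"
  shows "n ^ 3 \<le> 6 * (\<Sum>k=2..n. k\<^sup>2)"
  using assms
proof (induction n rule: nat_induct_at_least)
  case base
  show ?case by simp
next
  case (Suc n)
  then show ?case by (simp add: power3_eq_cube power2_eq_square algebra_simps)
qed

lemma sum_inverse_le_ln:
  assumes "n \<ge> 1"
  shows "(\<Sum>k=2..n. 1 / real k) \<le> ln (real n)"
  using assms
proof (induction n rule: nat_induct_at_least)
  case base
  show ?case by simp
next
  case (Suc n)
  have "ln (real n / real (Suc n)) \<le> real n / real (Suc n) - 1"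
    using Suc by (intro ln_le_minus_one) simp
  also have "\<dots> = - 1 / real (Suc n)" by (simp add: field_simps)
  also have "ln (real n / real (Suc n)) = ln (real n) - ln (real (Suc n))"
    using Suc.hyps by (simp add: ln_div)
  finally show ?case using Suc by simp
qed

text \<open>After an exchange of sums, the keys with at least \<open>n\<close> solutions are counted
  with weight \<open>n^2\<close>. Their number, of order \<open>t^2 / n^3\<close>, leaves a harmonic
  sum, cut off at \<open>t\<close> because no fiber has more than \<open>t\<close> elements.\<close>

lemma sum_card_fiber_cubes:
  assumes p: "prime p" and A: "mult_subgroup p A" and tp: "int ((card A)\<^sup>2) \<le> p"
  shows "real (\<Sum>k\<in>rich_keys p (card A) 2. card (power_fiber p (card A) k) ^ 3)
    \<le> 12 * 6144 ^ 3 * real (card A) ^ 2 * ln (real (card A))"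
proof -
  let ?t = "card A" and ?N = "\<lambda>k. card (power_fiber p (card A) k)" and ?\<Theta> = "rich_keys p (card A)"
  note t = card_mult_subgroup_pos[OF p A]
  have "(\<Sum>k\<in>?\<Theta> 2. ?N k ^ 3) \<le> (\<Sum>k\<in>?\<Theta> 2. 6 * (\<Sum>n=2..?N k. n\<^sup>2))"
    by (intro sum_mono cube_le_sum_squares) (simp add: rich_keys_def)
  also have "\<dots> = 6 * (\<Sum>k\<in>?\<Theta> 2. \<Sum>n=2..?t. if n \<le> ?N k then n\<^sup>2 else 0)"
    unfolding sum_distrib_left[symmetric]
  proof (rule arg_cong[where f = "(*) 6"], rule sum.cong[OF refl])
    fix k
    have "{2..?N k} = {2..?t} \<inter> {n. n \<le> ?N k}"
      using card_power_fiber_le[OF p t, of k] by auto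
    then show "(\<Sum>n=2..?N k. n\<^sup>2) = (\<Sum>n=2..?t. if n \<le> ?N k then n\<^sup>2 else 0)"
      by (simp add: sum.inter_restrict)
  qed
  also have "\<dots> = 6 * (\<Sum>n=2..?t. \<Sum>k\<in>?\<Theta> 2. if n \<le> ?N k then n\<^sup>2 else 0)"
    by (subst sum.swap) simp
  also have "\<dots> = 6 * (\<Sum>n=2..?t. n\<^sup>2 * card (?\<Theta> n))"
  proof (rule arg_cong[where f = "(*) 6"], rule sum.cong[OF refl])
    fix n assume "n \<in> {2..?t}"
    then have "?\<Theta> n = ?\<Theta> 2 \<inter> {k. n \<le> ?N k}" unfolding rich_keys_def by auto
    then show "(\<Sum>k\<in>?\<Theta> 2. if n \<le> ?N k then n\<^sup>2 else 0) = n\<^sup>2 * card (?\<Theta> n)"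
      using sum.inter_restrict[of "?\<Theta> 2" "\<lambda>_. n\<^sup>2" "{k. n \<le> ?N k}"]
      by (simp add: mult.commute)
  qed
  finally have "real (\<Sum>k\<in>?\<Theta> 2. ?N k ^ 3) \<le> real (6 * (\<Sum>n=2..?t. n\<^sup>2 * card (?\<Theta> n)))"
    by (simp only: of_nat_le_iff)
  also have "\<dots> = 6 * (\<Sum>n=2..?t. real (n\<^sup>2 * card (?\<Theta> n)))" by simp
  also have "\<dots> \<le> 6 * (\<Sum>n=2..?t. 2 * 6144 ^ 3 * real ?t ^ 2 * (1 / real n))"
  proof (intro mult_left_mono sum_mono)
    fix n assume n: "n \<in> {2..?t}"
    have "real (n ^ 3 * card (?\<Theta> n)) \<le> real (2 * 6144 ^ 3 * ?t\<^sup>2)"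
      using card_rich_keys_bound[OF p A tp, of n] n unfolding of_nat_le_iff by simp
    then show "real (n\<^sup>2 * card (?\<Theta> n)) \<le> 2 * 6144 ^ 3 * real ?t ^ 2 * (1 / real n)"
      using n by (simp add: field_simps power3_eq_cube power2_eq_square)
  qed simp
  also have "\<dots> = 12 * 6144 ^ 3 * real ?t ^ 2 * (\<Sum>n=2..?t. 1 / real n)"
    by (simp add: sum_distrib_left)
  also have "\<dots> \<le> 12 * 6144 ^ 3 * real ?t ^ 2 * ln (real ?t)"
    using t by (intro mult_left_mono sum_inverse_le_ln) auto
  finally show ?thesis .
qed

section \<open>Collinear triples\<close>

text \<open>
  The triples \<open>(x, x r, x s)\<close> and \<open>(x - 1, (x - 1) r', (x - 1) s')\<close> record the line
  \<open>x X + (1 - x) Y = 1\<close> through \<open>(1, 1)\<close> that contains \<open>(r, r')\<close> and \<open>(s, s')\<close>.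
\<close>

lemma ex_line_through_one:
  fixes p :: int
  assumes p: "prime p" and A: "mult_subgroup p A"
    and mem: "r \<in> A" "r' \<in> A" "s \<in> A" "s' \<in> A"
    and ne: "r \<noteq> 1" "r' \<noteq> 1" "r \<noteq> r'"
    and col: "[(r - 1) * (s' - 1) = (r' - 1) * (s - 1)] (mod p)"
  shows "\<exists>k\<in>rich_keys p (card A) 2. \<exists>x\<in>power_fiber p (card A) k. \<exists>y\<in>power_fiber p (card A) k.
    \<exists>z\<in>power_fiber p (card A) k. [x * r = y] (mod p) \<and> [(x - 1) * r' = y - 1] (mod p) \<and>
      [x * s = z] (mod p) \<and> [(x - 1) * s' = z - 1] (mod p)"
proof -
  let ?t = "card A"
  have rng: "r \<in> {1..<p}" "r' \<in> {1..<p}" "s \<in> {1..<p}" "s' \<in> {1..<p}"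
    using mem mult_subgroup_subset[OF p A] by auto
  have nd: "\<not> p dvd a - b" if "a \<noteq> b" "a \<in> {0..<p}" "b \<in> {0..<p}" for a b
    using that cong_residues_eq[of a b p] by (auto simp: cong_iff_dvd_diff)
  have one: "1 \<in> {0..<p}" using prime_gt_1_int[OF p] by simp
  \<comment> \<open>This solves \<open>x r + (1 - x) r' = 1\<close>. Given
    \<open>r \<noteq> r'\<close>, the conditions \<open>r' \<noteq> 1\<close> and
    \<open>r \<noteq> 1\<close> are what keep \<open>x\<close> and \<open>x - 1\<close> nonzero
    modulo \<open>p\<close>.\<close>
  obtain x where x: "x \<in> {0..<p}" "[x * (r - r') = 1 - r'] (mod p)"
    using ex_quotient_mod_prime[OF p nd[of r r']] ne rng by auto
  have x': "p dvd x * (r - r') - (1 - r')" using x(2) by (simp add: cong_iff_dvd_diff)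
  have x0: "\<not> p dvd x"
  proof
    assume "p dvd x"
    then have "p dvd x * (r - r') - (x * (r - r') - (1 - r'))" by (rule dvd_diff[OF dvd_mult2 x'])
    then show False using nd[of 1 r'] ne rng one by simp
  qed
  have x1: "\<not> p dvd x - 1"
  proof
    assume "p dvd x - 1"
    then have "p dvd (x * (r - r') - (1 - r')) - (x - 1) * (r - r')" by (rule dvd_diff[OF x' dvd_mult2])
    also have "\<dots> = r - 1" by algebra
    finally show False using nd[of r 1] ne rng one by simp
  qed
  have xr: "[x * r - 1 = (x - 1) * r'] (mod p)"
    using x' by (simp add: cong_iff_dvd_diff algebra_simps)
  have xs: "[x * s - 1 = (x - 1) * s'] (mod p)"
  proof -
    \<comment> \<open>The combination is \<open>r - r'\<close> times the equation of the line at
      \<open>(s, s')\<close>, so collinearity places this point on the line.\<close>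
    have "p dvd (s - s') * (x * (r - r') - (1 - r')) + ((r - 1) * (s' - 1) - (r' - 1) * (s - 1))"
      using x' col by (intro dvd_add dvd_mult) (simp_all add: cong_iff_dvd_diff)
    also have "\<dots> = (r - r') * (x * s - 1 - (x - 1) * s')" by algebra
    finally show ?thesis
      using p nd[of r r'] ne rng by (auto simp: prime_dvd_mult_iff cong_iff_dvd_diff)
  qed
  define k where "k = (x ^ ?t mod p, (x - 1) ^ ?t mod p)"
  define y where "y = (x * r) mod p"
  define z where "z = (x * s) mod p"
  have "a mod p \<in> {1..<p}" if "\<not> p dvd a" for a
  proof -
    have "a mod p \<noteq> 0" "0 \<le> a mod p" "a mod p < p"
      using that prime_gt_1_int[OF p] by (simp_all add: dvd_eq_mod_eq_0)
    then show ?thesis by (metis atLeastLessThan_iff int_one_le_iff_zero_less order_less_le)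
  qed
  moreover have "\<not> p dvd x ^ ?t" "\<not> p dvd (x - 1) ^ ?t"
    using x0 x1 p prime_dvd_power by blast+
  ultimately have k: "k \<in> {1..<p} \<times> {1..<p}" unfolding k_def by blast
  have xk: "x \<in> power_fiber p ?t k" using x unfolding power_fiber_def k_def by simp
  have fib: "(x * a) mod p \<in> power_fiber p ?t k"
    if a: "a \<in> A" "a' \<in> A" "[x * a - 1 = (x - 1) * a'] (mod p)" for a a'
  proof -
    have "[(x * a) ^ ?t = x ^ ?t * 1] (mod p)"
      unfolding power_mult_distrib by (intro cong_mult cong_refl mult_subgroup_power_card[OF p A] a)
    moreover have "[((x - 1) * a') ^ ?t = (x - 1) ^ ?t * 1] (mod p)"
      unfolding power_mult_distrib by (intro cong_mult cong_refl mult_subgroup_power_card[OF p A] a)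
    moreover have "[(x * a) mod p = x * a] (mod p)" by simp
    moreover from this have "[(x * a) mod p - 1 = (x - 1) * a'] (mod p)"
      using a(3) by (meson cong_diff cong_refl cong_trans)
    ultimately have "[((x * a) mod p) ^ ?t = x ^ ?t] (mod p)" "[((x * a) mod p - 1) ^ ?t = (x - 1) ^ ?t] (mod p)"
      by (metis cong_pow cong_trans mult.right_neutral)+
    then show ?thesis
      using prime_gt_1_int[OF p] unfolding power_fiber_def k_def by simp
  qed
  have yk: "y \<in> power_fiber p ?t k" unfolding y_def using fib[OF mem(1,2) xr] .
  have zk: "z \<in> power_fiber p ?t k" unfolding z_def using fib[OF mem(3,4) xs] .
  \<comment> \<open>Here \<open>r \<noteq> 1\<close> supplies a second element of the fiber, so that
    its key is among those with at least two solutions.\<close>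
  have "x \<noteq> y"
  proof
    assume "x = y"
    then have "[x * r = x * 1] (mod p)" by (simp add: y_def cong_def) (metis mod_mod_trivial)
    then have "[r = 1] (mod p)" using cong_mult_cancel_prime[OF p x0] by blast
    then show False using cong_residues_eq rng one ne by fastforce
  qed
  then have "card {x, y} = 2" by simp
  then have "2 \<le> card (power_fiber p ?t k)"
    using card_mono[OF finite_power_fiber, of "{x, y}" p ?t k] xk yk by simp
  then have "k \<in> rich_keys p ?t 2" using k unfolding rich_keys_def by simp
  moreover have "[x * r = y] (mod p)" "[x * s = z] (mod p)" by (simp_all add: y_def z_def)
  moreover from this have "[(x - 1) * r' = y - 1] (mod p)" "[(x - 1) * s' = z - 1] (mod p)"
    using xr xs by (meson cong_diff cong_refl cong_sym cong_trans)+
  ultimately show ?thesis using xk yk zk by blast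
qed

definition collinear_with_one :: "int \<Rightarrow> int set \<Rightarrow> ((int \<times> int) \<times> int \<times> int) set" where
  "collinear_with_one p A = {((r, r'), (s, s')) |r r' s s'. r \<in> A \<and> r' \<in> A \<and> s \<in> A \<and> s' \<in> A \<and>
     [(r - 1) * (s' - 1) = (r' - 1) * (s - 1)] (mod p)}"

lemma finite_collinear_with_one: "finite A \<Longrightarrow> finite (collinear_with_one p A)"
  by (rule finite_subset[of _ "(A \<times> A) \<times> A \<times> A"]) (auto simp: collinear_with_one_def)

text \<open>The data \<open>k, x, y, z\<close> lose nothing: \<open>x\<close> and
  \<open>x - 1\<close> are invertible modulo \<open>p\<close>, so \<open>r\<close>, \<open>s\<close>
  are the quotients of \<open>y\<close>, \<open>z\<close> by \<open>x\<close>, and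
  \<open>r'\<close>, \<open>s'\<close> those of \<open>y - 1\<close>, \<open>z - 1\<close> by
  \<open>x - 1\<close>.\<close>

lemma card_collinear_with_one_generic:
  assumes p: "prime p" and A: "mult_subgroup p A"
  shows "card {((r, r'), (s, s')) \<in> collinear_with_one p A. r \<noteq> 1 \<and> r' \<noteq> 1 \<and> r \<noteq> r'}
    \<le> (\<Sum>k\<in>rich_keys p (card A) 2. card (power_fiber p (card A) k) ^ 3)"
    (is "card ?C \<le> _")
proof -
  let ?t = "card A" and ?F = "power_fiber p (card A)"
  let ?Z = "Sigma (rich_keys p ?t 2) (\<lambda>k. ?F k \<times> ?F k \<times> ?F k)"
  let ?R = "\<lambda>((r, r'), (s, s')) (k, x, y, z). [x * r = y] (mod p) \<and> [(x - 1) * r' = y - 1] (mod p) \<and>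
      [x * s = z] (mod p) \<and> [(x - 1) * s' = z - 1] (mod p)"
  have "card ?C \<le> card ?Z"
  proof (rule card_le_if_inj_on_rel[where r = ?R])
    show "finite ?Z" by (intro finite_SigmaI finite_cartesian_product) simp_all
  next
    fix q assume "q \<in> ?C"
    then obtain r r' s s' where q: "q = ((r, r'), (s, s'))" "r \<in> A" "r' \<in> A" "s \<in> A" "s' \<in> A"
      "r \<noteq> 1" "r' \<noteq> 1" "r \<noteq> r'" "[(r - 1) * (s' - 1) = (r' - 1) * (s - 1)] (mod p)"
      by (auto simp: collinear_with_one_def)
    obtain k x y z where "k \<in> rich_keys p ?t 2" "x \<in> ?F k" "y \<in> ?F k" "z \<in> ?F k"
      "[x * r = y] (mod p)" "[(x - 1) * r' = y - 1] (mod p)"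
      "[x * s = z] (mod p)" "[(x - 1) * s' = z - 1] (mod p)"
      using ex_line_through_one[OF p A q(2-9)] by blast
    then show "\<exists>w. w \<in> ?Z \<and> ?R q w"
      unfolding q(1) by (intro exI[of _ "(k, x, y, z)"]) auto
  next
    fix q1 q2 w assume q: "q1 \<in> ?C" "q2 \<in> ?C" "w \<in> ?Z" "?R q1 w" "?R q2 w"
    obtain k x y z where w: "w = (k, x, y, z)" "k \<in> rich_keys p ?t 2" "x \<in> ?F k"
      using q(3) by blast
    have x: "\<not> p dvd x" "\<not> p dvd x - 1"
      using not_dvd_power_fiber[OF p card_mult_subgroup_pos[OF p A] _ w(3)] w(2)
      unfolding rich_keys_def by auto
    have uniq: "a = b" if "a \<in> A" "b \<in> A" "\<not> p dvd c" "[c * a = d] (mod p)" "[c * b = d] (mod p)" for a b c d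
    proof -
      have "[a = b] (mod p)"
        using cong_mult_cancel_prime[OF p that(3)] that(4,5) cong_sym cong_trans by blast
      moreover have "a \<in> {0..<p}" "b \<in> {0..<p}" using that(1,2) mult_subgroup_subset[OF p A] by auto
      ultimately show ?thesis by (rule cong_residues_eq)
    qed
    show "q1 = q2"
      using q(1,2,4,5) uniq[OF _ _ x(1)] uniq[OF _ _ x(2)]
      unfolding w(1) collinear_with_one_def by auto
  qed
  also have "card ?Z = (\<Sum>k\<in>rich_keys p ?t 2. card (?F k) ^ 3)"
    by (simp add: card_SigmaI card_cartesian_product power3_eq_cube mult.assoc)
  finally show ?thesis .
qed

text \<open>The lines through \<open>(1, 1)\<close> left out of the generic count are the vertical,
  the horizontal and the diagonal one. Together with the case that the first point is
  \<open>(1, 1)\<close> itself, they give four families, each parametrized by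
  \<open>A \<times> A\<close>.\<close>

lemma card_collinear_with_one:
  assumes p: "prime p" and A: "mult_subgroup p A"
  shows "card (collinear_with_one p A)
    \<le> 4 * (card A)\<^sup>2 + (\<Sum>k\<in>rich_keys p (card A) 2. card (power_fiber p (card A) k) ^ 3)"
proof -
  let ?C = "{((r, r'), (s, s')) \<in> collinear_with_one p A. r \<noteq> 1 \<and> r' \<noteq> 1 \<and> r \<noteq> r'}"
  let ?g = "[\<lambda>(a, b). ((1, 1), (a, b)), \<lambda>(a, b). ((1, a), (1, b)), \<lambda>(a, b). ((a, 1), (b, 1)),
    \<lambda>(a, b). ((a, a), (b, b))] :: (int \<times> int \<Rightarrow> (int \<times> int) \<times> int \<times> int) list"
  note fin = finite_mult_subgroup[OF p A]
  have "collinear_with_one p A \<subseteq> ?C \<union> (\<Union>f\<in>set ?g. f ` (A \<times> A))"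
  proof
    fix q assume q: "q \<in> collinear_with_one p A"
    then obtain r r' s s' where q': "q = ((r, r'), (s, s'))" "r \<in> A" "r' \<in> A" "s \<in> A" "s' \<in> A"
      and col: "[(r - 1) * (s' - 1) = (r' - 1) * (s - 1)] (mod p)"
      by (auto simp: collinear_with_one_def)
    have eq: "a = b" if "p dvd a - b" "a \<in> A" "b \<in> A" for a b
      using that cong_residues_eq[of a b p] mult_subgroup_subset[OF p A]
      by (force simp: cong_iff_dvd_diff)
    note one = one_in_mult_subgroup[OF p A]
    have "r = 1 \<and> r' = 1 \<or> r = 1 \<and> s = 1 \<or> r' = 1 \<and> s' = 1 \<or> r = r' \<and> s = s' \<or>
      (r \<noteq> 1 \<and> r' \<noteq> 1 \<and> r \<noteq> r')"
    proof -
      have "r' = 1 \<or> s = 1" if "r = 1"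
      proof -
        have "p dvd (r' - 1) * (s - 1)" using col that by (simp add: cong_iff_dvd_diff)
        then show ?thesis using p eq one q' by (auto simp: prime_dvd_mult_iff)
      qed
      moreover have "r = 1 \<or> s' = 1" if "r' = 1"
      proof -
        have "p dvd (r - 1) * (s' - 1)" using col that by (simp add: cong_iff_dvd_diff)
        then show ?thesis using p eq one q' by (auto simp: prime_dvd_mult_iff)
      qed
      moreover have "r = 1 \<or> s' = s" if "r' = r"
      proof -
        have "p dvd (r - 1) * (s' - s)" using col that by (simp add: cong_iff_dvd_diff algebra_simps)
        then show ?thesis using p eq one q' by (auto simp: prime_dvd_mult_iff)
      qed
      ultimately show ?thesis by blast
    qed
    then show "q \<in> ?C \<union> (\<Union>f\<in>set ?g. f ` (A \<times> A))"
      using q q' by (auto simp: image_iff)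
  qed
  then have "card (collinear_with_one p A) \<le> card (?C \<union> (\<Union>f\<in>set ?g. f ` (A \<times> A)))"
    using fin by (intro card_mono) (auto intro: finite_subset[OF _ finite_collinear_with_one[OF fin]])
  also have "\<dots> \<le> card ?C + card (\<Union>f\<in>set ?g. f ` (A \<times> A))"
    by (rule card_Un_le)
  also have "card (\<Union>f\<in>set ?g. f ` (A \<times> A)) \<le> (\<Sum>f\<in>set ?g. card (f ` (A \<times> A)))"
    by (rule card_UN_le) simp
  also have "\<dots> \<le> (\<Sum>f\<in>set ?g. card (A \<times> A))"
    using fin by (intro sum_mono card_image_le) simp
  also have "\<dots> \<le> 4 * card (A \<times> A)"
    using card_length[of ?g] by simp
  also have "\<dots> = 4 * (card A)\<^sup>2" by (simp add: card_cartesian_product power2_eq_square)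
  finally show ?thesis using card_collinear_with_one_generic[OF p A] by linarith
qed

text \<open>The three points are \<open>(a, a')\<close>, \<open>(b, b')\<close>,
  \<open>(c, c')\<close>. Grouping by coordinates instead of by points makes a pair of triples with
  equal ratio literally an element of this set.\<close>

definition collinear_triples :: "int \<Rightarrow> int set \<Rightarrow> ((int \<times> int \<times> int) \<times> int \<times> int \<times> int) set" where
  "collinear_triples p A = {((a, b, c), (a', b', c')) |a b c a' b' c'.
     a \<in> A \<and> b \<in> A \<and> c \<in> A \<and> a' \<in> A \<and> b' \<in> A \<and> c' \<in> A \<and>
     [(b - a) * (c' - a') = (b' - a') * (c - a)] (mod p)}"

lemma finite_collinear_triples: "finite A \<Longrightarrow> finite (collinear_triples p A)"
  by (rule finite_subset[of _ "(A \<times> A \<times> A) \<times> A \<times> A \<times> A"]) (auto simp: collinear_triples_def)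

text \<open>Dividing the coordinates by \<open>a\<close> and \<open>a'\<close> is a diagonal linear
  map that preserves \<open>A \<times> A\<close> and collinearity; in the determinant condition it
  amounts to cancelling \<open>a * a'\<close>.\<close>

lemma card_collinear_triples_le:
  assumes p: "prime p" and A: "mult_subgroup p A"
  shows "card (collinear_triples p A) \<le> (card A)\<^sup>2 * card (collinear_with_one p A)"
proof -
  let ?Z = "(A \<times> A) \<times> collinear_with_one p A"
  let ?R = "\<lambda>((a, b, c), (a', b', c')) ((u, u'), ((r, r'), (s, s'))). a = u \<and> a' = u' \<and>
    [r * u = b] (mod p) \<and> [r' * u' = b'] (mod p) \<and> [s * u = c] (mod p) \<and> [s' * u' = c'] (mod p)"
  note fin = finite_mult_subgroup[OF p A]
  have nd: "\<not> p dvd a" if "a \<in> A" for a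
    using that not_dvd_residue mult_subgroup_subset[OF p A] by blast
  have "card (collinear_triples p A) \<le> card ?Z"
  proof (rule card_le_if_inj_on_rel[where r = ?R])
    show "finite ?Z" using fin finite_collinear_with_one[OF fin] by blast
  next
    fix q assume "q \<in> collinear_triples p A"
    then obtain a b c a' b' c' where q: "q = ((a, b, c), (a', b', c'))"
      "a \<in> A" "b \<in> A" "c \<in> A" "a' \<in> A" "b' \<in> A" "c' \<in> A"
      "[(b - a) * (c' - a') = (b' - a') * (c - a)] (mod p)"
      by (auto simp: collinear_triples_def)
    have quot: "\<exists>r\<in>A. [r * u = v] (mod p)" if "u \<in> A" "v \<in> A" for u v
    proof -
      have "[v ^ card A = u ^ card A] (mod p)"
        using mult_subgroup_power_card[OF p A] that cong_sym cong_trans by blast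
      then show ?thesis using ex_mult_subgroup_quotient[OF p A nd[OF that(1)]] by metis
    qed
    obtain r r' s s' where rs: "r \<in> A" "[r * a = b] (mod p)" "r' \<in> A" "[r' * a' = b'] (mod p)"
      "s \<in> A" "[s * a = c] (mod p)" "s' \<in> A" "[s' * a' = c'] (mod p)"
      using quot q by metis
    have "[(r * a - a) * (s' * a' - a') = (b - a) * (c' - a')] (mod p)"
      by (intro cong_mult cong_diff cong_refl rs)
    also have "[(b - a) * (c' - a') = (b' - a') * (c - a)] (mod p)" by (rule q)
    also have "[(b' - a') * (c - a) = (r' * a' - a') * (s * a - a)] (mod p)"
      by (intro cong_mult cong_diff cong_refl cong_sym[OF rs(4)] cong_sym[OF rs(6)])
    finally have "[(a * a') * ((r - 1) * (s' - 1)) = (a * a') * ((r' - 1) * (s - 1))] (mod p)"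
      by (simp add: algebra_simps)
    moreover have "\<not> p dvd a * a'" using p nd q by (simp add: prime_dvd_mult_iff)
    ultimately have "[(r - 1) * (s' - 1) = (r' - 1) * (s - 1)] (mod p)"
      using cong_mult_cancel_prime[OF p] by blast
    then show "\<exists>w. w \<in> ?Z \<and> ?R q w"
      using q rs by (intro exI[of _ "((a, a'), ((r, r'), (s, s')))"]) (auto simp: collinear_with_one_def)
  next
    fix q1 q2 w assume q: "q1 \<in> collinear_triples p A" "q2 \<in> collinear_triples p A" "w \<in> ?Z"
      "?R q1 w" "?R q2 w"
    have uniq: "a = b" if "a \<in> A" "b \<in> A" "[d = a] (mod p)" "[d = b] (mod p)" for a b d
    proof -
      have "[a = b] (mod p)" using that(3,4) cong_sym cong_trans by blast
      moreover have "a \<in> {0..<p}" "b \<in> {0..<p}" using that(1,2) mult_subgroup_subset[OF p A] by auto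
      ultimately show ?thesis by (rule cong_residues_eq)
    qed
    show "q1 = q2"
      using q uniq unfolding collinear_triples_def by auto
  qed
  then show ?thesis by (simp add: card_cartesian_product power2_eq_square)
qed

text \<open>This lets terms without a logarithm, such as the \<open>4 t^2\<close> degenerate pairs,
  be absorbed into those with one.\<close>

lemma half_le_ln:
  fixes n :: nat
  assumes "n \<ge> 2"
  shows "1 / 2 \<le> ln (real n)"
proof -
  have "ln (1 / 2 :: real) \<le> 1 / 2 - 1" by (rule ln_le_minus_one) simp
  then have "1 / 2 \<le> ln (2 :: real)" by (simp add: ln_div)
  also have "\<dots> \<le> ln (real n)" using assms by simp
  finally show ?thesis .
qed

theorem card_collinear_triples_bound:
  assumes p: "prime p" and A: "mult_subgroup p A" and tp: "int ((card A)\<^sup>2) \<le> p" and "card A \<ge> 2"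
  shows "real (card (collinear_triples p A))
    \<le> (8 + 12 * 6144 ^ 3) * real (card A) ^ 4 * ln (real (card A))"
proof -
  let ?t = "card A"
  note ln = half_le_ln[OF \<open>card A \<ge> 2\<close>]
  have "real (card (collinear_with_one p A)) \<le> real (4 * ?t\<^sup>2 +
      (\<Sum>k\<in>rich_keys p ?t 2. card (power_fiber p ?t k) ^ 3))"
    using card_collinear_with_one[OF p A] by (simp only: of_nat_le_iff)
  also have "\<dots> \<le> 4 * real ?t ^ 2 + 12 * 6144 ^ 3 * real ?t ^ 2 * ln (real ?t)"
    using sum_card_fiber_cubes[OF p A tp] by simp
  also have "\<dots> \<le> 8 * real ?t ^ 2 * ln (real ?t) + 12 * 6144 ^ 3 * real ?t ^ 2 * ln (real ?t)"
    using mult_left_mono[OF ln, of "8 * real ?t ^ 2"] by simp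
  also have "\<dots> = (8 + 12 * 6144 ^ 3) * real ?t ^ 2 * ln (real ?t)" by (simp add: algebra_simps)
  finally have "real ?t ^ 2 * real (card (collinear_with_one p A))
      \<le> real ?t ^ 2 * ((8 + 12 * 6144 ^ 3) * real ?t ^ 2 * ln (real ?t))"
    by (rule mult_left_mono) simp
  moreover have "real (card (collinear_triples p A)) \<le> real (?t\<^sup>2 * card (collinear_with_one p A))"
    using card_collinear_triples_le[OF p A] by (simp only: of_nat_le_iff)
  ultimately show ?thesis by (simp add: power2_eq_square power4_eq_xxxx mult_ac)
qed

section \<open>Subsets with differences in a coset\<close>

lemma card_squared_le_card_fibers:
  assumes "finite X" and "finite R" and "f ` X \<subseteq> R"
  shows "(card X)\<^sup>2 \<le> card R * card {(x, y) \<in> X \<times> X. f x = f y}"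
proof -
  let ?n = "\<lambda>z. card {x \<in> X. f x = z}"
  have "real (card X) = (\<Sum>z\<in>R. real (?n z))"
    using sum.group[OF assms, of "\<lambda>_. 1 :: real"] assms(1) by simp
  then have "(real (card X))\<^sup>2 \<le> (\<Sum>z\<in>R. (real (?n z))\<^sup>2) * real (card R)"
    by (simp only: sum_squared_le_sum_of_squares)
  also have "(\<Sum>z\<in>R. (real (?n z))\<^sup>2) = real (card {(x, y) \<in> X \<times> X. f x = f y})"
  proof -
    have "{(x, y) \<in> X \<times> X. f x = f y} = (\<Union>z\<in>R. {x \<in> X. f x = z} \<times> {x \<in> X. f x = z})"
      using assms(3) by auto
    also have "card \<dots> = (\<Sum>z\<in>R. card ({x \<in> X. f x = z} \<times> {x \<in> X. f x = z}))"
      using assms by (intro card_UN_disjoint) auto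
    finally show ?thesis by (simp add: card_cartesian_product power2_eq_square)
  qed
  finally have "real ((card X)\<^sup>2) \<le> real (card R * card {(x, y) \<in> X \<times> X. f x = f y})"
    by (simp add: mult.commute)
  then show ?thesis by (simp only: of_nat_le_iff)
qed

lemma card_distinct_triples_ge:
  assumes "finite B"
  shows "card B ^ 3 \<le> card {(a, b, c) \<in> B \<times> B \<times> B. a \<noteq> b \<and> a \<noteq> c \<and> b \<noteq> c} + 3 * (card B)\<^sup>2"
proof -
  let ?X = "{(a, b, c) \<in> B \<times> B \<times> B. a \<noteq> b \<and> a \<noteq> c \<and> b \<noteq> c}"
  let ?g = "[\<lambda>(a, b). (a, a, b), \<lambda>(a, b). (a, b, a), \<lambda>(a, b). (b, a, a)]
    :: ('a \<times> 'a \<Rightarrow> 'a \<times> 'a \<times> 'a) list"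
  have "card (B \<times> B \<times> B) \<le> card (?X \<union> (\<Union>f\<in>set ?g. f ` (B \<times> B)))"
  proof (rule card_mono)
    show "finite (?X \<union> (\<Union>f\<in>set ?g. f ` (B \<times> B)))"
      using assms by (auto intro: finite_subset[of _ "B \<times> B \<times> B"])
    show "B \<times> B \<times> B \<subseteq> ?X \<union> (\<Union>f\<in>set ?g. f ` (B \<times> B))"
      by (auto simp: image_iff)
  qed
  also have "\<dots> \<le> card ?X + card (\<Union>f\<in>set ?g. f ` (B \<times> B))"
    by (rule card_Un_le)
  also have "card (\<Union>f\<in>set ?g. f ` (B \<times> B)) \<le> (\<Sum>f\<in>set ?g. card (f ` (B \<times> B)))"
    by (rule card_UN_le) simp
  also have "\<dots> \<le> (\<Sum>f\<in>set ?g. card (B \<times> B))"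
    using assms by (intro sum_mono card_image_le) simp
  also have "\<dots> \<le> 3 * card (B \<times> B)"
    using card_length[of ?g] by simp
  finally show ?thesis by (simp add: card_cartesian_product power2_eq_square power3_eq_cube mult.assoc)
qed

text \<open>The key \<open>(1, 1)\<close> names the pair \<open>(\<Gamma>, \<Gamma>)\<close>. The
  dilation \<open>\<xi>\<close> cancels in quotients, so the ratio is
  \<open>g\<^sub>1 / g\<^sub>2\<close>, and subtracting 1 gives
  \<open>g\<^sub>3 / g\<^sub>2\<close>.\<close>

lemma ratio_in_fiber:
  assumes p: "prime p" and \<Gamma>: "mult_subgroup p \<Gamma>" and \<xi>: "\<xi> \<in> {1..<p}"
    and g: "g\<^sub>1 \<in> \<Gamma>" "g\<^sub>2 \<in> \<Gamma>" "g\<^sub>3 \<in> \<Gamma>"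
    and d: "[b - a = \<xi> * g\<^sub>1] (mod p)" "[c - a = \<xi> * g\<^sub>2] (mod p)" "[b - c = \<xi> * g\<^sub>3] (mod p)"
  shows "\<exists>l\<in>power_fiber p (card \<Gamma>) (1, 1). [b - a = l * (c - a)] (mod p)"
proof -
  let ?g = "card \<Gamma>"
  have nd: "\<not> p dvd x" if "x \<in> \<Gamma>" for x
    using that not_dvd_residue mult_subgroup_subset[OF p \<Gamma>] by blast
  have \<xi>': "\<not> p dvd \<xi>" using not_dvd_residue[OF \<xi>] .
  obtain l where l: "l \<in> {0..<p}" "[l * g\<^sub>2 = g\<^sub>1] (mod p)"
    using ex_quotient_mod_prime[OF p nd[OF g(2)]] by blast
  have "[(b - a) - (c - a) = \<xi> * g\<^sub>1 - \<xi> * g\<^sub>2] (mod p)" by (intro cong_diff d)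
  then have "[b - c = \<xi> * (g\<^sub>1 - g\<^sub>2)] (mod p)" by (simp add: algebra_simps)
  from cong_trans[OF cong_sym[OF this] d(3)]
  have g3: "[g\<^sub>1 - g\<^sub>2 = g\<^sub>3] (mod p)" by (rule cong_mult_cancel_prime[OF p \<xi>'])
  have "[l * g\<^sub>2 - g\<^sub>2 = g\<^sub>1 - g\<^sub>2] (mod p)" by (intro cong_diff cong_refl l)
  from cong_trans[OF this g3]
  have l1: "[(l - 1) * g\<^sub>2 = g\<^sub>3] (mod p)" by (simp add: algebra_simps)
  have pow: "[m ^ ?g = 1] (mod p)" if "[m * g\<^sub>2 = h] (mod p)" "h \<in> \<Gamma>" for m h
  proof -
    have "[m ^ ?g * 1 = m ^ ?g * g\<^sub>2 ^ ?g] (mod p)"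
      by (intro cong_mult cong_refl cong_sym[OF mult_subgroup_power_card[OF p \<Gamma> g(2)]])
    also have "m ^ ?g * g\<^sub>2 ^ ?g = (m * g\<^sub>2) ^ ?g" by (simp add: power_mult_distrib)
    also have "[(m * g\<^sub>2) ^ ?g = h ^ ?g] (mod p)" using that(1) by (rule cong_pow)
    also have "[h ^ ?g = 1] (mod p)" using mult_subgroup_power_card[OF p \<Gamma> that(2)] .
    finally show ?thesis by simp
  qed
  have "l \<in> power_fiber p ?g (1, 1)"
    unfolding power_fiber_def using l(1) pow[OF l(2) g(1)] pow[OF l1 g(3)] by simp
  moreover have "[b - a = l * (c - a)] (mod p)"
  proof -
    have "[\<xi> * (l * g\<^sub>2) = \<xi> * g\<^sub>1] (mod p)" by (intro cong_mult cong_refl l)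
    moreover have "[l * (c - a) = l * (\<xi> * g\<^sub>2)] (mod p)" by (intro cong_mult cong_refl d)
    ultimately show ?thesis
      using cong_trans[OF d(1) cong_sym] cong_trans cong_sym by (simp add: mult.left_commute) blast
  qed
  ultimately show ?thesis by blast
qed

lemma card_distinct_triples_le:
  assumes p: "prime p" and A: "mult_subgroup p A" and \<Gamma>: "mult_subgroup p \<Gamma>" and \<xi>: "\<xi> \<in> {1..<p}"
    and "B \<subseteq> A" and diff: "\<And>b c. b \<in> B \<Longrightarrow> c \<in> B \<Longrightarrow> b \<noteq> c \<Longrightarrow> \<exists>g\<in>\<Gamma>. [b - c = \<xi> * g] (mod p)"
  shows "(card {(a, b, c) \<in> B \<times> B \<times> B. a \<noteq> b \<and> a \<noteq> c \<and> b \<noteq> c})\<^sup>2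
    \<le> card (power_fiber p (card \<Gamma>) (1, 1)) * card (collinear_triples p A)"
proof -
  let ?X = "{(a, b, c) \<in> B \<times> B \<times> B. a \<noteq> b \<and> a \<noteq> c \<and> b \<noteq> c}"
  let ?R = "power_fiber p (card \<Gamma>) (1, 1)"
  have finA: "finite A" using finite_mult_subgroup[OF p A] .
  have finB: "finite B" using \<open>B \<subseteq> A\<close> finA by (rule finite_subset)
  have finX: "finite ?X" using finB by (auto intro: finite_subset[of _ "B \<times> B \<times> B"])
  have "\<exists>l\<in>?R. [b - a = l * (c - a)] (mod p)" if "(a, b, c) \<in> ?X" for a b c
  proof -
    have "a \<in> B" "b \<in> B" "c \<in> B" "b \<noteq> a" "c \<noteq> a" "b \<noteq> c" using that by auto
    then obtain g\<^sub>1 g\<^sub>2 g\<^sub>3 where "g\<^sub>1 \<in> \<Gamma>" "g\<^sub>2 \<in> \<Gamma>" "g\<^sub>3 \<in> \<Gamma>"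
      "[b - a = \<xi> * g\<^sub>1] (mod p)" "[c - a = \<xi> * g\<^sub>2] (mod p)" "[b - c = \<xi> * g\<^sub>3] (mod p)"
      using diff by metis
    then show ?thesis by (rule ratio_in_fiber[OF p \<Gamma> \<xi>])
  qed
  then have "\<forall>x\<in>?X. \<exists>l. l \<in> ?R \<and> [fst (snd x) - fst x = l * (snd (snd x) - fst x)] (mod p)"
    by (intro ballI) (simp only: split_paired_all fst_conv snd_conv Bex_def)
  then obtain f where "\<forall>x\<in>?X. f x \<in> ?R \<and>
      [fst (snd x) - fst x = f x * (snd (snd x) - fst x)] (mod p)"
    by (rule bchoice[THEN exE])
  note f = bspec[OF this]
  \<comment> \<open>With a common ratio \<open>f x = f y\<close>, both sides of the determinant
    condition equal \<open>f x * (c - a) * (c' - a')\<close>.\<close>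
  have "{(x, y) \<in> ?X \<times> ?X. f x = f y} \<subseteq> collinear_triples p A"
  proof
    fix q assume "q \<in> {(x, y) \<in> ?X \<times> ?X. f x = f y}"
    then obtain x y where xy: "q = (x, y)" "x \<in> ?X" "y \<in> ?X" "f x = f y" by blast
    obtain a b c a' b' c' where e: "x = (a, b, c)" "y = (a', b', c')"
      by (metis prod_cases3)
    have "[(b - a) * (c' - a') = (f x * (c - a)) * (c' - a')] (mod p)"
      using f[OF xy(2)] unfolding e(1) by (intro cong_mult cong_refl) simp
    moreover have "[(b' - a') * (c - a) = (f x * (c' - a')) * (c - a)] (mod p)"
      using f[OF xy(3)] unfolding xy(4) e(2) by (intro cong_mult cong_refl) simp
    moreover have "(f x * (c' - a')) * (c - a) = (f x * (c - a)) * (c' - a')"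
      by (simp only: mult_ac)
    ultimately have "[(b - a) * (c' - a') = (b' - a') * (c - a)] (mod p)"
      by (simp only: cong_def)
    then show "q \<in> collinear_triples p A"
      using xy(2,3) \<open>B \<subseteq> A\<close> unfolding xy(1) e collinear_triples_def by auto
  qed
  then have "card {(x, y) \<in> ?X \<times> ?X. f x = f y} \<le> card (collinear_triples p A)"
    by (rule card_mono[OF finite_collinear_triples[OF finA]])
  moreover have "(card ?X)\<^sup>2 \<le> card ?R * card {(x, y) \<in> ?X \<times> ?X. f x = f y}"
    using f by (intro card_squared_le_card_fibers finX) auto
  ultimately show ?thesis by (meson le_trans mult_le_mono2)
qed

section \<open>Real exponents and the final estimates\<close>

lemma int_square_le_if_less_sqrt:
  assumes "real n < sqrt (real_of_int p)"
  shows "int (n\<^sup>2) \<le> p"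
proof -
  have "0 \<le> real_of_int p" using assms by (smt (verit) of_nat_0_le_iff real_sqrt_lt_0_iff)
  then have "(real n)\<^sup>2 < (sqrt (real_of_int p))\<^sup>2" using assms by (intro power_strict_mono) auto
  then have "real_of_int (int (n\<^sup>2)) < real_of_int p" using \<open>0 \<le> real_of_int p\<close> by simp
  then show ?thesis by linarith
qed

lemma int_power4_le_if_less_powr:
  assumes "real n < real_of_int p powr (3/4)" and "p > 0"
  shows "int (n ^ 4) \<le> p ^ 3"
proof -
  have "real n ^ 4 < (real_of_int p powr (3/4)) ^ 4" using assms by (intro power_strict_mono) auto
  also have "\<dots> = real_of_int p powr (of_nat 4 * (3/4))"
    using assms(2) by (intro powr_power) simp
  also have "\<dots> = real_of_int p powr (real 3)" by simp
  also have "\<dots> = real_of_int p ^ 3"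
    using assms(2) by (intro powr_realpow) simp
  finally have "real_of_int (int (n ^ 4)) < real_of_int (p ^ 3)" by simp
  then show ?thesis by linarith
qed

lemma le_powr_two_thirds_if_cube_le:
  fixes N g :: nat
  assumes "N ^ 3 \<le> 96 ^ 3 * g\<^sup>2" and "g > 0"
  shows "real N \<le> 96 * real g powr (2/3)"
proof (rule power_le_imp_le_base)
  have "(real g powr (2/3)) ^ 3 = real g powr (real 2)"
    using \<open>g > 0\<close> by (simp add: powr_power)
  also have "\<dots> = real g ^ 2" using \<open>g > 0\<close> by (intro powr_realpow) simp
  finally have "(96 * real g powr (2/3)) ^ 3 = real (96 ^ 3 * g\<^sup>2)"
    by (simp add: power_mult_distrib)
  moreover have "real (N ^ 3) \<le> real (96 ^ 3 * g\<^sup>2)" using assms(1) by (simp only: of_nat_le_iff)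
  ultimately show "real N ^ Suc 2 \<le> (96 * real g powr (2/3)) ^ Suc 2" by simp
qed simp

text \<open>For \<open>card B \<ge> 4\<close> the triples with a repetition number at most
  \<open>3 |B|^2 \<le> (3/4) |B|^3\<close>, so a quarter of all triples is left. Squaring that loss
  gives 16, and \<open>1536 = 16 * 96\<close> with the 96 of Stepanov's bound. For smaller
  \<open>B\<close> the constant alone exceeds \<open>3^6\<close>, even after the factor 1/2 lost to
  the logarithm.\<close>

theorem difference_in_coset_bound:
  assumes p: "prime p" and A: "mult_subgroup p A" and \<Gamma>: "mult_subgroup p \<Gamma>"
    and tp: "real (card A) < sqrt (real_of_int p)" and gp: "real (card \<Gamma>) < real_of_int p powr (3/4)"
    and t: "card A \<ge> 2" and \<xi>: "\<xi> \<in> {1..<p}" and "B \<subseteq> A"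
    and diff: "\<And>b c. b \<in> B \<Longrightarrow> c \<in> B \<Longrightarrow> b \<noteq> c \<Longrightarrow> \<exists>g\<in>\<Gamma>. [b - c = \<xi> * g] (mod p)"
  shows "real (card B) ^ 6 \<le> (1536 * (8 + 12 * 6144 ^ 3)) * real (card A) ^ 4 *
    real (card \<Gamma>) powr (2/3) * ln (real (card A))"
proof (cases "card B \<ge> 4")
  case True
  let ?X = "{(a, b, c) \<in> B \<times> B \<times> B. a \<noteq> b \<and> a \<noteq> c \<and> b \<noteq> c}"
  let ?R = "power_fiber p (card \<Gamma>) (1, 1)" and ?T = "collinear_triples p A"
  have p1: "p > 1" using prime_gt_1_int[OF p] .
  note g = card_mult_subgroup_pos[OF p \<Gamma>]
  have "finite B" using \<open>B \<subseteq> A\<close> finite_mult_subgroup[OF p A] by (rule finite_subset)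
  have "4 * card B ^ 3 \<le> 4 * card ?X + 3 * (4 * (card B)\<^sup>2)"
    using card_distinct_triples_ge[OF \<open>finite B\<close>] by simp
  also have "4 * (card B)\<^sup>2 \<le> card B ^ 3"
    using True by (simp add: power3_eq_cube power2_eq_square)
  finally have "card B ^ 3 \<le> 4 * card ?X" by simp
  then have "(card B ^ 3)\<^sup>2 \<le> (4 * card ?X)\<^sup>2" by (rule power_mono) simp
  also have "\<dots> = 16 * (card ?X)\<^sup>2" by (simp add: power_mult_distrib)
  also have "\<dots> \<le> 16 * (card ?R * card ?T)"
    using card_distinct_triples_le[OF p A \<Gamma> \<xi> \<open>B \<subseteq> A\<close> diff] by (rule mult_le_mono2)
  finally have "real ((card B ^ 3)\<^sup>2) \<le> real (16 * (card ?R * card ?T))" by (simp only: of_nat_le_iff)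
  then have "real (card B) ^ 6 \<le> 16 * (real (card ?R) * real (card ?T))" by (simp flip: power_mult)
  also have "\<dots> \<le> 16 * ((96 * real (card \<Gamma>) powr (2/3)) *
      ((8 + 12 * 6144 ^ 3) * real (card A) ^ 4 * ln (real (card A))))"
  proof (intro mult_left_mono mult_mono)
    have "card ?R ^ 3 \<le> 96 ^ 3 * (card \<Gamma>)\<^sup>2"
      using p1 gp by (intro card_power_fiber_bound[OF p g] int_power4_le_if_less_powr) auto
    then show "real (card ?R) \<le> 96 * real (card \<Gamma>) powr (2/3)"
      using g by (rule le_powr_two_thirds_if_cube_le)
    show "real (card ?T) \<le> (8 + 12 * 6144 ^ 3) * real (card A) ^ 4 * ln (real (card A))"
      using card_collinear_triples_bound[OF p A int_square_le_if_less_sqrt[OF tp] t] .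
  qed auto
  finally show ?thesis by (simp add: mult_ac)
next
  case False
  then have "real (card B) ^ 6 \<le> 3 ^ 6" by (intro power_mono) auto
  also have "\<dots> \<le> (1536 * (8 + 12 * 6144 ^ 3)) * 1 * 1 * (1 / 2 :: real)" by simp
  also have "\<dots> \<le> (1536 * (8 + 12 * 6144 ^ 3)) * real (card A) ^ 4 *
      real (card \<Gamma>) powr (2/3) * ln (real (card A))"
  proof (intro mult_mono)
    show "1 \<le> real (card A) ^ 4" using t by (intro one_le_power) simp
    show "1 \<le> real (card \<Gamma>) powr (2/3)"
      using card_mult_subgroup_pos[OF p \<Gamma>] by (intro ge_one_powr_ge_zero) auto
    show "1 / 2 \<le> ln (real (card A))" using half_le_ln[OF t] .
  qed auto
  finally show ?thesis .
qed

lemma diff_mod_memD: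
  assumes d: "diff_mod p S \<subseteq> dilate_mod p \<xi> \<Gamma> \<union> {0}"
    and "x \<in> S" "y \<in> S" "[x = b + s] (mod p)" "[y = c + s] (mod p)" and bc: "\<not> [b = c] (mod p)"
  shows "\<exists>g\<in>\<Gamma>. [b - c = \<xi> * g] (mod p)"
proof -
  have xy: "[x - y = b - c] (mod p)"
    using cong_diff[OF assms(4,5)] by simp
  then have "(x - y) mod p \<noteq> 0"
    using bc by (metis cong_def cong_0_iff cong_iff_dvd_diff dvd_eq_mod_eq_0)
  moreover have "(x - y) mod p \<in> diff_mod p S" using assms unfolding diff_mod_def by blast
  ultimately obtain g where "g \<in> \<Gamma>" "(x - y) mod p = (\<xi> * g) mod p"
    using d unfolding dilate_mod_def by blast
  then show ?thesis using xy unfolding cong_def by metis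
qed

lemma shifted_subset_bound:
  assumes p: "prime p" and A: "mult_subgroup p A" and \<Gamma>: "mult_subgroup p \<Gamma>"
    and "real (card A) < sqrt (real_of_int p)" and "real (card \<Gamma>) < real_of_int p powr (3/4)"
    and "card A \<ge> 2" and \<xi>: "\<xi> \<in> {1..<p}" and sub: "A' \<subseteq> shift_mod p A s"
    and d: "diff_mod p A' \<subseteq> dilate_mod p \<xi> \<Gamma> \<union> {0}"
  shows "real (card A') ^ 6 \<le> (1536 * (8 + 12 * 6144 ^ 3)) * real (card A) ^ 4 *
    real (card \<Gamma>) powr (2/3) * ln (real (card A))"
proof -
  let ?f = "\<lambda>a. (a + s) mod p"
  define B where "B = {a \<in> A. ?f a \<in> A'}"
  have "A' = ?f ` B" using sub unfolding B_def shift_mod_def by blast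
  have ncong: "\<not> [b = c] (mod p)" if "b \<in> A" "c \<in> A" "b \<noteq> c" for b c
  proof -
    have "b \<in> {0..<p}" "c \<in> {0..<p}" using that mult_subgroup_subset[OF p A] by auto
    then show ?thesis using cong_residues_eq that(3) by blast
  qed
  have "inj_on ?f B"
  proof (rule inj_onI)
    fix b c assume "b \<in> B" "c \<in> B" "?f b = ?f c"
    then have "[b + s = c + s] (mod p)" by (simp add: cong_def)
    then have "[b = c] (mod p)" by (simp add: cong_iff_dvd_diff)
    then show "b = c" using ncong \<open>b \<in> B\<close> \<open>c \<in> B\<close> unfolding B_def by blast
  qed
  then have "card A' = card B" unfolding \<open>A' = ?f ` B\<close> by (rule card_image)
  moreover have "real (card B) ^ 6 \<le> (1536 * (8 + 12 * 6144 ^ 3)) * real (card A) ^ 4 *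
    real (card \<Gamma>) powr (2/3) * ln (real (card A))"
  proof (rule difference_in_coset_bound[OF assms(1-7)])
    show "B \<subseteq> A" unfolding B_def by blast
    fix b c assume "b \<in> B" "c \<in> B" "b \<noteq> c"
    then show "\<exists>g\<in>\<Gamma>. [b - c = \<xi> * g] (mod p)"
      using ncong unfolding B_def
      by (intro diff_mod_memD[OF d, of "?f b" "?f c" b s c]) auto
  qed
  ultimately show ?thesis by simp
qed

text \<open>This permits replacing the logarithm of |A| by that of |\<Gamma>|. The differences
  \<open>a - 1\<close> give |A| \<le> |\<Gamma>| + 1, and \<open>a - 1\<close> and
  \<open>1 - a\<close> yield two distinct elements of \<open>\<Gamma>\<close>.\<close>

lemma card_le_square_if_diff_subset:
  assumes p: "prime p" and A: "mult_subgroup p A" and \<Gamma>: "mult_subgroup p \<Gamma>"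
    and tp: "real (card A) < sqrt (real_of_int p)" and t: "card A \<ge> 2" and \<xi>: "\<xi> \<in> {1..<p}"
    and d: "diff_mod p A \<subseteq> dilate_mod p \<xi> \<Gamma> \<union> {0}"
  shows "card \<Gamma> \<ge> 2" and "card A \<le> (card \<Gamma>)\<^sup>2"
proof -
  have diff: "\<exists>g\<in>\<Gamma>. [b - c = \<xi> * g] (mod p)" if "b \<in> A" "c \<in> A" "b \<noteq> c" for b c
  proof (rule diff_mod_memD[OF d that(1,2)])
    have "b \<in> {0..<p}" "c \<in> {0..<p}" using that mult_subgroup_subset[OF p A] by auto
    then show "\<not> [b = c] (mod p)" using cong_residues_eq that(3) by blast
    show "[b = b + 0] (mod p)" "[c = c + 0] (mod p)" by simp_all
  qed
  note one = one_in_mult_subgroup[OF p A] and fin = finite_mult_subgroup[OF p A]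
  have fin\<Gamma>: "finite \<Gamma>" using finite_mult_subgroup[OF p \<Gamma>] .
  have residue: "x \<in> {0..<p}" if "x \<in> A" for x using that mult_subgroup_subset[OF p A] by auto
  have "card (A - {1}) \<le> card \<Gamma>"
  proof (rule card_le_if_inj_on_rel[where r = "\<lambda>a g. [a - 1 = \<xi> * g] (mod p)"])
    show "\<exists>g. g \<in> \<Gamma> \<and> [a - 1 = \<xi> * g] (mod p)" if "a \<in> A - {1}" for a
      using diff[of a 1] one that by auto
    fix a b g assume "a \<in> A - {1}" "b \<in> A - {1}" "[a - 1 = \<xi> * g] (mod p)" "[b - 1 = \<xi> * g] (mod p)"
    then have "[a - 1 = b - 1] (mod p)" using cong_sym cong_trans by blast
    then have "[a = b] (mod p)" by (simp add: cong_iff_dvd_diff)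
    then show "a = b" using cong_residues_eq residue \<open>a \<in> A - {1}\<close> \<open>b \<in> A - {1}\<close> by blast
  qed (rule fin\<Gamma>)
  then have le: "card A \<le> card \<Gamma> + 1" using one fin by simp
  have "\<not> A \<subseteq> {1}" using t card_mono[of "{1}" A] by auto
  then obtain a where a: "a \<in> A" "a \<noteq> 1" by blast
  obtain g h where g: "g \<in> \<Gamma>" "[a - 1 = \<xi> * g] (mod p)" and h: "h \<in> \<Gamma>" "[1 - a = \<xi> * h] (mod p)"
    using diff[OF a(1) one a(2)] diff[OF one a(1)] a(2) by metis
  have "g \<noteq> h"
  proof
    assume "g = h"
    then have "p dvd (a - 1) - (1 - a)" using g h cong_sym cong_trans cong_iff_dvd_diff by blast
    also have "(a - 1) - (1 - a) = 2 * (a - 1)" by simp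
    finally consider "p dvd 2" | "p dvd a - 1" using prime_dvd_multD[OF p] by blast
    then show False
    proof cases
      \<comment> \<open>The prime is odd: \<open>card A \<ge> 2\<close> and the square root bound
        give \<open>p \<ge> 4\<close>.\<close>
      case 1
      then have "p \<le> 2" by (rule zdvd_imp_le) simp
      moreover have "2\<^sup>2 \<le> (card A)\<^sup>2" using t by (rule power_mono) simp
      then have "int (2\<^sup>2) \<le> int ((card A)\<^sup>2)" by (simp only: of_nat_le_iff)
      ultimately show False using int_square_le_if_less_sqrt[OF tp] by simp
    next
      case 2
      then have "[a = 1] (mod p)" by (simp add: cong_iff_dvd_diff)
      then show False using cong_residues_eq residue a one by blast
    qed
  qed
  then show g2: "card \<Gamma> \<ge> 2" using card_mono[OF fin\<Gamma>, of "{g, h}"] g h by simp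
  have "card \<Gamma> + 1 \<le> 2 * card \<Gamma>" using g2 by simp
  also have "\<dots> \<le> (card \<Gamma>)\<^sup>2" using g2 by (simp add: power2_eq_square)
  finally show "card A \<le> (card \<Gamma>)\<^sup>2" using le by simp
qed

text \<open>Dividing by \<open>a^4\<close> and using \<open>ln a \<le> 2 ln g\<close> bounds
  \<open>a^2\<close> with the constant \<open>2 * C\<close>. As \<open>C \<ge> 2\<close>, this is at
  most \<open>C^2\<close>, so the same constant serves after the square root is taken.\<close>

lemma full_subgroup_bound:
  fixes C :: real
  assumes C: "C \<ge> 2" and a: "a \<ge> 2" and g: "g \<ge> 2" and ag: "a \<le> g\<^sup>2"
    and bound: "real a ^ 6 \<le> C * real a ^ 4 * real g powr (2/3) * ln (real a)"
  shows "real a \<le> C * real g powr (1/3) * sqrt (ln (real g))"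
proof (rule power2_le_imp_le)
  have "real a ^ 4 * (real a)\<^sup>2 \<le> real a ^ 4 * (C * real g powr (2/3) * ln (real a))"
    using bound by (simp add: mult_ac flip: power_add)
  then have "(real a)\<^sup>2 \<le> C * real g powr (2/3) * ln (real a)"
    using a by (simp only: mult_le_cancel_left_pos zero_less_power of_nat_0_less_iff)
  also have "\<dots> \<le> C * real g powr (2/3) * (2 * ln (real g))"
  proof (rule mult_left_mono)
    have "ln (real a) \<le> ln (real (g\<^sup>2))" using ag a g by (intro ln_mono) (auto simp del: of_nat_power)
    then show "ln (real a) \<le> 2 * ln (real g)" using g by (simp add: ln_realpow)
  qed (use C in simp)
  also have "\<dots> = 2 * (C * real g powr (2/3) * ln (real g))" by simp
  also have "\<dots> \<le> C * (C * real g powr (2/3) * ln (real g))"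
    using C g by (intro mult_right_mono) auto
  also have "real g powr (2/3) = (real g powr (1/3))\<^sup>2"
    by (simp add: power2_eq_square flip: powr_add)
  also have "C * (C * (real g powr (1/3))\<^sup>2 * ln (real g)) = (C * real g powr (1/3) * sqrt (ln (real g)))\<^sup>2"
    using g by (simp add: power_mult_distrib power2_eq_square)
  finally show "(real a)\<^sup>2 \<le> (C * real g powr (1/3) * sqrt (ln (real g)))\<^sup>2" .
  show "0 \<le> C * real g powr (1/3) * sqrt (ln (real g))" using C g by simp
qed

theorem theorem8:
  shows "\<exists>c>0.
    (\<forall>p A \<Gamma> A' s \<xi>. prime p \<and> mult_subgroup p A \<and> mult_subgroup p \<Gamma> \<and>
        real (card A) < sqrt (real_of_int p) \<and> real (card \<Gamma>) < real_of_int p powr (3/4) \<and>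
        card A \<ge> 2 \<and>
        s \<in> {0..<p} \<and> A' \<subseteq> shift_mod p A s \<and>
        \<xi> \<in> {1..<p} \<and> diff_mod p A' \<subseteq> dilate_mod p \<xi> \<Gamma> \<union> {0}
      \<longrightarrow> real (card A') ^ 6 \<le> c * real (card A) ^ 4 * real (card \<Gamma>) powr (2/3) * ln (real (card A)))
  \<and> (\<forall>p A \<Gamma> \<xi>. prime p \<and> mult_subgroup p A \<and> mult_subgroup p \<Gamma> \<and>
        real (card A) < sqrt (real_of_int p) \<and> real (card \<Gamma>) < real_of_int p powr (3/4) \<and>
        card A \<ge> 2 \<and>
        \<xi> \<in> {1..<p} \<and> diff_mod p A \<subseteq> dilate_mod p \<xi> \<Gamma> \<union> {0}
      \<longrightarrow> real (card A) \<le> c * real (card \<Gamma>) powr (1/3) * sqrt (ln (real (card \<Gamma>))))"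
proof (intro exI[of _ "1536 * (8 + 12 * 6144 ^ 3)"] conjI allI impI; (elim conjE)?)
  show "(0 :: real) < 1536 * (8 + 12 * 6144 ^ 3)" by simp
next
  fix p :: int and A \<Gamma> A' :: "int set" and s \<xi> :: int
  assume "prime p" "mult_subgroup p A" "mult_subgroup p \<Gamma>"
    "real (card A) < sqrt (real_of_int p)" "real (card \<Gamma>) < real_of_int p powr (3/4)"
    "card A \<ge> 2" "\<xi> \<in> {1..<p}" "A' \<subseteq> shift_mod p A s"
    "diff_mod p A' \<subseteq> dilate_mod p \<xi> \<Gamma> \<union> {0}"
  then show "real (card A') ^ 6 \<le> (1536 * (8 + 12 * 6144 ^ 3)) * real (card A) ^ 4 *
      real (card \<Gamma>) powr (2/3) * ln (real (card A))"
    by (rule shifted_subset_bound)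
next
  fix p :: int and A \<Gamma> :: "int set" and \<xi> :: int
  assume *: "prime p" "mult_subgroup p A" "mult_subgroup p \<Gamma>"
    "real (card A) < sqrt (real_of_int p)" "real (card \<Gamma>) < real_of_int p powr (3/4)"
    "card A \<ge> 2" "\<xi> \<in> {1..<p}" and d: "diff_mod p A \<subseteq> dilate_mod p \<xi> \<Gamma> \<union> {0}"
  have "A \<subseteq> shift_mod p A 0"
    using mult_subgroup_subset[OF *(1,2)] unfolding shift_mod_def by force
  from shifted_subset_bound[OF * this d]
  show "real (card A) \<le> (1536 * (8 + 12 * 6144 ^ 3)) * real (card \<Gamma>) powr (1/3) *
      sqrt (ln (real (card \<Gamma>)))"
    by (intro full_subgroup_bound card_le_square_if_diff_subset[OF *(1-4,6,7) d] *(6)) simp_all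
qed

end
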